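(* Every germ of a smooth nondegenerate fibration of $\mathbb R^n$ by oriented affine $k$-planes extends to such a fibration of all of $\mathbb R^n$. That is, if $T\subset\mathbb R^n$ is an open set carrying a smooth nondegenerate fibration by oriented affine $k$-planes and $P$ is one of its fibers, then there is a smooth nondegenerate fibration of all of $\mathbb R^n$ by oriented affine $k$-planes which coincides with the given one on some open neighborhood of $P$.
   Context: $G_k(n)$ denotes the Grassmannian of oriented linear $k$-planes in $\mathbb R^n$. A fibration of an open set $T\subset\mathbb R^n$ by oriented affine $k$-planes is a family of pairwise disjoint oriented affine $k$-planes with union $T$ such that the map sending a point to its fiber is continuous; it is smooth if the map $\pi\colon T\to G_k(n)$, sending $x$ to the oriented linear $k$-plane parallel to the fiber through $x$, is smooth (and the fibration is locally smoothly trivial). For $u\in G_k(n)$ let $\varphi_u\colon \mathrm{Hom}(u,u^\perp)\to G_k(n)$ send a linear map $L$ to its graph $\{t+Lt:t\in u\}$, oriented via $u$; it is a diffeomorphism onto a neighborhood of $u$. A smooth fibration is nondegenerate if for every $x\in T$, with $u=\pi(x)$, the linear map $D_x=d(\varphi_u^{-1}\circ\pi|_{(x+u^\perp)\cap T})_x\colon u^\perp\to \mathrm{Hom}(u,u^\perp)$ has the property that $D_x(\xi)$ is injective for every nonzero $\xi\in u^\perp$ (i.e. $(\xi,t)\mapsto D_x(\xi)t$ is a nonsingular bilinear map; equivalently, $\pi$ restricted to $x+u^\perp$ is an immersion at $x$ transverse to the bad cone $\{u'\in G_k(n): u'\cap u\neq 0\}$). A bilinear map $\beta$ is nonsingular if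 $\beta(a,b)=0$ implies $a=0$ or $b=0$. *)

theory Defs
  imports "HOL-Analysis.Analysis"
begin

text \<open>C^k and C^infinity maps between real normed vector spaces (on open sets).
  C^(m+1): differentiable and every directional derivative x |-> Df(x) v is C^m;
  in finite dimensions this is the usual notion.\<close>

fun Ck_on :: "nat \<Rightarrow> 'a::real_normed_vector set \<Rightarrow> ('a \<Rightarrow> 'b::real_normed_vector) \<Rightarrow> bool" where
  "Ck_on 0 S f = continuous_on S f"
| "Ck_on (Suc m) S f =
     (f differentiable_on S \<and> (\<forall>v. Ck_on m S (\<lambda>x. frechet_derivative f (at x) v)))"

definition smooth_on :: "'a::real_normed_vector set \<Rightarrow> ('a \<Rightarrow> 'b::real_normed_vector) \<Rightarrow> bool" where
  "smooth_on S f \<longleftrightarrow> (\<forall>m. Ck_on m S f)"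

text \<open>Oriented linear k-planes in R^n, k = CARD('k), n = CARD('n).
  A frame is an injective n x k matrix (its columns are a basis of the plane);
  an oriented plane is the class of a frame modulo right multiplication by
  k x k matrices of positive determinant.\<close>

definition oriented_plane_of :: "real^'k^'n \<Rightarrow> (real^'k^'n) set" where
  "oriented_plane_of M = {M ** B | B :: real^'k^'k. det B > 0}"

definition OGr :: "((real^'k::finite^'n::finite) set) set" where
  "OGr = {oriented_plane_of M | M :: real^'k^'n. inj (\<lambda>t. M *v t)}"

definition ospan :: "(real^'k::finite^'n::finite) set \<Rightarrow> (real^'n) set" where
  "ospan u = (\<Union>M\<in>u. range (\<lambda>t. M *v t))"

text \<open>Hom(u, u^perp), realised as the n x n matrices mapping u into u^perp and
  vanishing on u^perp (extension by zero).\<close>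
definition Hom_perp :: "(real^'k::finite^'n::finite) set \<Rightarrow> (real^'n^'n) set" where
  "Hom_perp u = {L. (\<forall>z\<in>ospan u. L *v z \<in> orthogonal_comp (ospan u)) \<and>
                    (\<forall>z\<in>orthogonal_comp (ospan u). L *v z = 0)}"

text \<open>The chart phi_u: L |-> graph of L, oriented via u.\<close>
definition chart :: "(real^'k::finite^'n::finite) set \<Rightarrow> real^'n^'n \<Rightarrow> (real^'k^'n) set" where
  "chart u L = {(mat 1 + L) ** M | M. M \<in> u}"

definition chart_inv :: "(real^'k::finite^'n::finite) set \<Rightarrow> (real^'k^'n) set \<Rightarrow> real^'n^'n" where
  "chart_inv u w = (THE L. L \<in> Hom_perp u \<and> chart u L = w)"

text \<open>A fibration of the open set T by oriented affine k-planes, encoded by the map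
  pi sending x to the oriented linear plane parallel to its fiber; the fiber
  through x is x + ospan (pi x) with orientation pi x.  The condition says
  every fiber lies in T and all points of a fiber carry the same oriented
  direction, i.e. the fibers are pairwise disjoint and cover T.\<close>
definition plane_fibration :: "(real^'n) set \<Rightarrow> (real^'n::finite \<Rightarrow> (real^'k::finite^'n) set) \<Rightarrow> bool" where
  "plane_fibration T \<pi> \<longleftrightarrow> open T \<and> (\<forall>x\<in>T. \<pi> x \<in> OGr) \<and>
     (\<forall>x\<in>T. \<forall>v\<in>ospan (\<pi> x). x + v \<in> T \<and> \<pi> (x + v) = \<pi> x)"

definition fiber :: "(real^'n::finite \<Rightarrow> (real^'k::finite^'n) set) \<Rightarrow> real^'n \<Rightarrow> (real^'n) set" where
  "fiber \<pi> x = {x + v | v. v \<in> ospan (\<pi> x)}"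

definition smooth_plane_map :: "(real^'n) set \<Rightarrow> (real^'n::finite \<Rightarrow> (real^'k::finite^'n) set) \<Rightarrow> bool" where
  "smooth_plane_map T \<pi> \<longleftrightarrow> (\<forall>x\<in>T. \<exists>U. open U \<and> x \<in> U \<and> U \<subseteq> T \<and>
      (\<forall>y\<in>U. \<pi> y \<in> chart (\<pi> x) ` Hom_perp (\<pi> x)) \<and>
      smooth_on U (\<lambda>y. chart_inv (\<pi> x) (\<pi> y)))"

definition nondegenerate :: "(real^'n) set \<Rightarrow> (real^'n::finite \<Rightarrow> (real^'k::finite^'n) set) \<Rightarrow> bool" where
  "nondegenerate T \<pi> \<longleftrightarrow> (\<forall>x\<in>T.
     let u = \<pi> x;
         D = frechet_derivative (\<lambda>y. chart_inv u (\<pi> y))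
               (at x within ({x + \<xi> | \<xi>. \<xi> \<in> orthogonal_comp (ospan u)} \<inter> T))
     in \<forall>\<xi>\<in>orthogonal_comp (ospan u). \<forall>t\<in>ospan u.
          \<xi> \<noteq> 0 \<longrightarrow> t \<noteq> 0 \<longrightarrow> D \<xi> *v t \<noteq> 0)"

definition smooth_nondeg_fibration :: "(real^'n) set \<Rightarrow> (real^'n::finite \<Rightarrow> (real^'k::finite^'n) set) \<Rightarrow> bool" where
  "smooth_nondeg_fibration T \<pi> \<longleftrightarrow>
     plane_fibration T \<pi> \<and> smooth_plane_map T \<pi> \<and> nondegenerate T \<pi>"

end

theory Submission
  imports Defs
begin

text \<open>
  Let u be the direction of the fiber through x0, U its span and V the orthogonal complement of U.
  Near x0 the fibration consists of the planes (x0 + y) + graph (B y) with y small in V and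
  B 0 = 0.  Let \<beta> be the derivative of B at 0.  Nondegeneracy at x0, together with the fact that
  nearby fibers do not focus, gives a v + \<beta>(v) t \<noteq> 0 for v in V nonzero, t in U and
  (a, t) nonzero, hence a lower bound c |(a, t)| |v| by compactness.  Therefore the linear formula
  y \<mapsto> (x0 + y) + graph (\<beta> y) is a nondegenerate fibration of the whole space, and this survives
  adding to \<beta> any smooth H with small derivative: for each t the map y \<mapsto> y + (\<beta> y + H y) t
  is a bijection of V by Banach's fixed point theorem, with smooth inverse.  As B - \<beta> vanishes to second
  order at 0, cutting it off on a small enough ball gives such an H, which equals B - \<beta> near 0.
\<close>

section \<open>Calculus of C^k maps\<close>

text \<open>The parameter t runs through an unbounded space, so the smallness of \<open>H\<close>
  has to be measured relative to t. Everything is linear in t, and the inequality c |(a, t)| |v| <=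
  |a v + \<beta>(v) t| gives this uniformity: a = 1 makes the planes disjoint and exhausting, a = 0
  makes them nondegenerate, and a perturbation with derivative at most c/2 costs half of the bound
  in both cases. That fibers do not focus is forced by smoothness: if v + \<beta>(v) t = 0, the
  point with parameter t on the plane through x0 + s v has velocity zero at s = 0, so the direction
  at that point, being differentiable near x0 + t, has derivative zero; this derivative is
  \<beta>(v), hence v = 0. Only B - \<beta> is cut off, since the linear model must survive far
  away. A cutoff at radius \<epsilon> costs a factor 1/\<epsilon>, paid for by |B y - \<beta> y| <=
  \<eta> |y|. The neighborhood found is a union of whole fibers of the new fibration, so no uniform
  width along the unbounded fiber has to be found.\<close>

lemma has_derivative_frechet_derivative:
  "f differentiable at x \<Longrightarrow> (f has_derivative frechet_derivative f (at x)) (at x)"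
  by (simp add: frechet_derivative_works)

lemma Ck_on_cong:
  assumes "open S" "\<And>x. x \<in> S \<Longrightarrow> f x = g x"
  shows "Ck_on m S f \<longleftrightarrow> Ck_on m S g"
  using assms(2)
proof (induction m arbitrary: f g)
  case 0
  then show ?case by (simp cong: continuous_on_cong)
next
  case (Suc m)
  have D: "(f has_derivative D) (at x) \<longleftrightarrow> (g has_derivative D) (at x)" if "x \<in> S" for x D
    using that Suc.prems has_derivative_transform_within_open[OF _ assms(1) that] by metis
  then have eq: "frechet_derivative f (at x) = frechet_derivative g (at x)" if "x \<in> S" for x
    unfolding frechet_derivative_def using D that by simp
  have "f differentiable_on S \<longleftrightarrow> g differentiable_on S"
    using D by (simp add: differentiable_on_eq_differentiable_at assms(1) differentiable_def)
  moreover have "Ck_on m S (\<lambda>x. frechet_derivative f (at x) v) \<longleftrightarrow>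
      Ck_on m S (\<lambda>x. frechet_derivative g (at x) v)" for v
    by (rule Suc.IH) (simp add: eq)
  ultimately show ?case by simp
qed

lemma Ck_on_SucI:
  assumes "open S" "\<And>x. x \<in> S \<Longrightarrow> (f has_derivative f' x) (at x)"
    and "\<And>v. Ck_on m S (\<lambda>x. f' x v)"
  shows "Ck_on (Suc m) S f"
proof -
  have "f differentiable_on S"
    using assms(2) by (meson differentiable_at_withinI differentiable_def differentiable_on_def)
  moreover have "Ck_on m S (\<lambda>x. frechet_derivative f (at x) v)" for v
    using assms(3)[of v] Ck_on_cong[OF assms(1), of "\<lambda>x. frechet_derivative f (at x) v" "\<lambda>x. f' x v" m]
    by (metis assms(2) frechet_derivative_at)
  ultimately show ?thesis by simp
qed

lemma Ck_on_SucD: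
  assumes "open S" "Ck_on (Suc m) S f"
  shows "x \<in> S \<Longrightarrow> (f has_derivative frechet_derivative f (at x)) (at x)"
    and "Ck_on m S (\<lambda>x. frechet_derivative f (at x) v)"
  using assms by (auto simp: differentiable_on_eq_differentiable_at has_derivative_frechet_derivative)

lemma Ck_on_subset:
  assumes "open S" "T \<subseteq> S" "Ck_on m S f"
  shows "Ck_on m T f"
  using assms(3)
proof (induction m arbitrary: f)
  case 0
  then show ?case using assms by (auto intro: continuous_on_subset)
next
  case (Suc m)
  then show ?case using assms by (auto intro: differentiable_on_subset)
qed

lemma Ck_on_imp_continuous_on: "Ck_on m S f \<Longrightarrow> continuous_on S f"
  by (cases m) (auto intro: differentiable_imp_continuous_on)

lemma Ck_on_Suc_imp: "Ck_on (Suc m) S f \<Longrightarrow> Ck_on m S f"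
proof (induction m arbitrary: f)
  case 0
  then show ?case using Ck_on_imp_continuous_on by (metis Ck_on.simps(1))
next
  case (Suc m)
  then show ?case by (metis Ck_on.simps(2))
qed

text \<open>Derivatives are taken at points of the ambient space, so every clause of the definition
  can be checked near one point. This glues functions given by different formulas on overlapping
  open sets.\<close>

lemma Ck_on_local:
  assumes "\<And>x. x \<in> S \<Longrightarrow> \<exists>U. open U \<and> x \<in> U \<and> Ck_on m U f"
  shows "Ck_on m S f"
  using assms
proof (induction m arbitrary: f)
  case 0
  then have "isCont f x" if "x \<in> S" for x
    using that continuous_on_eq_continuous_at by fastforce
  then show ?case by (simp add: continuous_at_imp_continuous_on)
next
  case (Suc m)
  have "f differentiable_on S"
    unfolding differentiable_on_def
    using Suc.prems
    by (metis Ck_on.simps(2) differentiable_at_withinI differentiable_on_eq_differentiable_at)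
  moreover have "Ck_on m S (\<lambda>x. frechet_derivative f (at x) v)" for v
    using Suc.prems by (intro Suc.IH) (metis Ck_on.simps(2))
  ultimately show ?case by simp
qed

lemma Ck_on_const: "open S \<Longrightarrow> Ck_on m S (\<lambda>x. c)"
proof (induction m arbitrary: c)
  case (Suc m)
  then show ?case by (intro Ck_on_SucI[where f'="\<lambda>x v. 0"]) auto
qed simp

lemma Ck_on_linear_compose:
  assumes "open S" "bounded_linear h" "Ck_on m S f"
  shows "Ck_on m S (\<lambda>x. h (f x))"
  using assms(3)
proof (induction m arbitrary: f)
  case 0
  then show ?case using assms(2) by (simp add: bounded_linear.continuous_on)
next
  case (Suc m)
  show ?case
  proof (rule Ck_on_SucI[OF assms(1)])
    show "((\<lambda>x. h (f x)) has_derivative (\<lambda>v. h (frechet_derivative f (at x) v))) (at x)" if "x \<in> S" for x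
      using bounded_linear.has_derivative[OF assms(2)] Ck_on_SucD(1)[OF assms(1) Suc.prems that] .
  qed (intro Suc.IH Ck_on_SucD(2)[OF assms(1) Suc.prems])
qed

lemma Ck_on_bounded_linear:
  assumes "open S" "bounded_linear h"
  shows "Ck_on m S h"
proof (cases m)
  case 0
  then show ?thesis using assms(2) linear_continuous_on by auto
next
  case (Suc m)
  show ?thesis unfolding Suc
    by (rule Ck_on_SucI[where f'="\<lambda>x. h"])
      (use assms in \<open>auto intro: bounded_linear_imp_has_derivative Ck_on_const\<close>)
qed

lemma Ck_on_id: "open S \<Longrightarrow> Ck_on m S (\<lambda>x. x)"
  using Ck_on_bounded_linear[OF _ bounded_linear_ident] .

lemma Ck_on_add:
  assumes "open S" "Ck_on m S f" "Ck_on m S g"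
  shows "Ck_on m S (\<lambda>x. f x + g x)"
  using assms(2,3)
proof (induction m arbitrary: f g)
  case 0
  then show ?case by (simp add: continuous_on_add)
next
  case (Suc m)
  note D = Ck_on_SucD[OF assms(1) Suc.prems(1)] Ck_on_SucD[OF assms(1) Suc.prems(2)]
  show ?case
    by (rule Ck_on_SucI[OF assms(1) has_derivative_add[OF D(1,3)]])
      (auto intro: Suc.IH D(2,4))
qed

lemma Ck_on_sum:
  assumes "open S" "finite I" "\<And>i. i \<in> I \<Longrightarrow> Ck_on m S (f i)"
  shows "Ck_on m S (\<lambda>x. \<Sum>i\<in>I. f i x)"
  using assms(2,3)
  by (induction I rule: finite_induct) (auto intro: Ck_on_const Ck_on_add assms(1))

lemma Ck_on_bilinear:
  assumes "bounded_bilinear h" "open S" "Ck_on m S f" "Ck_on m S g"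
  shows "Ck_on m S (\<lambda>x. h (f x) (g x))"
  using assms(3,4)
proof (induction m arbitrary: f g)
  case 0
  then show ?case using bounded_bilinear.continuous_on[OF assms(1)] by simp
next
  case (Suc m)
  note D = Ck_on_SucD[OF assms(2) Suc.prems(1)] Ck_on_SucD[OF assms(2) Suc.prems(2)]
  note C = Suc.prems[THEN Ck_on_Suc_imp]
  show ?case
    by (rule Ck_on_SucI[OF assms(2) bounded_bilinear.FDERIV[OF assms(1) D(1,3)]])
      (assumption | intro Ck_on_add assms Suc.IH C D(2,4))+
qed

lemmas Ck_on_mult = Ck_on_bilinear[OF bounded_bilinear_mult]
lemmas Ck_on_scaleR = Ck_on_bilinear[OF bounded_bilinear_scaleR]
lemmas Ck_on_inner = Ck_on_bilinear[OF bounded_bilinear_inner]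

lemma Ck_on_diff:
  assumes "open S" "Ck_on m S f" "Ck_on m S g"
  shows "Ck_on m S (\<lambda>x. f x - g x)"
  using Ck_on_add[OF assms(1,2) Ck_on_linear_compose[OF assms(1) _ assms(3), of uminus]]
  by (simp add: bounded_linear_minus bounded_linear_ident)

text \<open>The chain rule produces the derivative of \<open>g\<close> in the direction
  \<open>Df(x) v\<close>, which moves with x, while the induction hypothesis speaks about fixed
  directions. Expanding that vector in \<open>Basis\<close> gives a finite sum of fixed-direction
  derivatives of \<open>g\<close> with scalar coefficients of class C^m.\<close>

lemma Ck_on_compose:
  fixes f :: "'a::real_normed_vector \<Rightarrow> 'b::euclidean_space" and g :: "'b \<Rightarrow> 'c::real_normed_vector"
  assumes "open S" "open T" "\<And>x. x \<in> S \<Longrightarrow> f x \<in> T" "Ck_on m S f" "Ck_on m T g"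
  shows "Ck_on m S (\<lambda>x. g (f x))"
  using assms(4,5)
proof (induction m arbitrary: g)
  case 0
  then show ?case using assms(3) continuous_on_compose2[of T g S f] by (auto simp: image_subset_iff)
next
  case (Suc m)
  note Df = Ck_on_SucD[OF assms(1) Suc.prems(1)] and Dg = Ck_on_SucD[OF assms(2) Suc.prems(2)]
  let ?f' = "\<lambda>x. frechet_derivative f (at x)" and ?g' = "\<lambda>y. frechet_derivative g (at y)"
  show ?case
  proof (rule Ck_on_SucI[OF assms(1)])
    fix x assume x: "x \<in> S"
    have lin: "linear (?g' (f x))"
      using Dg(1)[OF assms(3)[OF x]] has_derivative_linear by blast
    have "(\<Sum>b\<in>Basis. (?f' x v \<bullet> b) *\<^sub>R ?g' (f x) b) = ?g' (f x) (?f' x v)" for v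
      using linear_sum[OF lin, of "\<lambda>b. (?f' x v \<bullet> b) *\<^sub>R b" Basis]
      by (simp add: euclidean_representation linear_scale[OF lin])
    moreover have "((\<lambda>x. g (f x)) has_derivative (\<lambda>v. ?g' (f x) (?f' x v))) (at x)"
      by (rule has_derivative_compose[OF Df(1)[OF x] Dg(1)[OF assms(3)[OF x]]])
    ultimately show "((\<lambda>x. g (f x)) has_derivative
        (\<lambda>v. \<Sum>b\<in>Basis. (?f' x v \<bullet> b) *\<^sub>R ?g' (f x) b)) (at x)" by simp
  next
    fix v
    show "Ck_on m S (\<lambda>x. \<Sum>b\<in>Basis. (?f' x v \<bullet> b) *\<^sub>R ?g' (f x) b)"
      by (intro Ck_on_sum Ck_on_scaleR Ck_on_inner Ck_on_const assms(1) Df(2) finite_Basis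
          Suc.IH[OF Ck_on_Suc_imp[OF Suc.prems(1)] Dg(2)])
  qed
qed

text \<open>The derivative is a polynomial in the function itself, so the induction closes.\<close>

lemma Ck_on_inverse_real: "Ck_on m (- {0}) (inverse :: real \<Rightarrow> real)"
proof (induction m)
  case 0
  show ?case unfolding Ck_on.simps by (intro continuous_on_inverse continuous_on_id) auto
next
  case (Suc m)
  show ?case
  proof (rule Ck_on_SucI)
    show "(inverse has_derivative (\<lambda>v. - (inverse x * v * inverse x))) (at x)" if "x \<in> - {0}" for x :: real
      using that has_derivative_inverse' by auto
    show "Ck_on m (- {0}) (\<lambda>x::real. - (inverse x * v * inverse x))" for v
      by (intro Ck_on_mult Suc.IH Ck_on_const open_Compl Ck_on_linear_compose[of _ uminus]
          bounded_linear_minus bounded_linear_ident) auto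
  qed auto
qed

lemma Ck_on_inverse:
  fixes f :: "'a::real_normed_vector \<Rightarrow> real"
  assumes "open S" "Ck_on m S f" "\<And>x. x \<in> S \<Longrightarrow> f x \<noteq> 0"
  shows "Ck_on m S (\<lambda>x. inverse (f x))"
  by (rule Ck_on_compose[OF assms(1) _ _ assms(2) Ck_on_inverse_real]) (use assms(3) in auto)

lemma Ck_on_divide:
  fixes f :: "'a::real_normed_vector \<Rightarrow> real"
  assumes "open S" "Ck_on m S f" "Ck_on m S g" "\<And>x. x \<in> S \<Longrightarrow> g x \<noteq> 0"
  shows "Ck_on m S (\<lambda>x. f x / g x)"
  unfolding divide_inverse by (intro Ck_on_mult Ck_on_inverse assms)

lemma Ck_on_prod:
  fixes f :: "'i \<Rightarrow> 'a::real_normed_vector \<Rightarrow> real"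
  assumes "open S" "finite I" "\<And>i. i \<in> I \<Longrightarrow> Ck_on m S (f i)"
  shows "Ck_on m S (\<lambda>x. \<Prod>i\<in>I. f i x)"
  using assms(2,3)
  by (induction I rule: finite_induct) (auto intro: Ck_on_const Ck_on_mult assms(1))

lemma Ck_on_vec_nth:
  fixes f :: "'a::real_normed_vector \<Rightarrow> 'b::euclidean_space^'i"
  assumes "open S" "Ck_on m S f"
  shows "Ck_on m S (\<lambda>x. f x $ i)"
  using Ck_on_linear_compose[OF assms(1) bounded_linear_vec_nth assms(2)] .

lemma Ck_on_vec:
  fixes f :: "'a::real_normed_vector \<Rightarrow> 'b::euclidean_space^'i"
  assumes "open S" "\<And>i. Ck_on m S (\<lambda>x. f x $ i)"
  shows "Ck_on m S f"
proof -
  have "linear (\<lambda>y::'b. axis i y)" for i :: 'i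
    by (rule linearI) (auto simp: axis_def vec_eq_iff)
  then have "Ck_on m S (\<lambda>x. \<Sum>i\<in>UNIV. axis i (f x $ i))"
    by (intro Ck_on_sum assms Ck_on_linear_compose[of S "axis _"]) (auto simp: linear_conv_bounded_linear)
  moreover have "(\<Sum>i\<in>UNIV. axis i (y $ i)) = y" for y :: "'b^'i"
    by (simp add: vec_eq_iff axis_def)
  ultimately show ?thesis by simp
qed

lemma Ck_on_det:
  fixes M :: "'a::real_normed_vector \<Rightarrow> real^'i^'i"
  assumes "open S" "\<And>i j. Ck_on m S (\<lambda>x. M x $ i $ j)"
  shows "Ck_on m S (\<lambda>x. det (M x))"
  unfolding det_def by (intro Ck_on_sum Ck_on_mult Ck_on_prod Ck_on_const assms) auto

text \<open>By Cramer's rule each coordinate of the solution is a quotient of determinants, hence a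
  rational expression in the coefficients and the right-hand side.\<close>

lemma Ck_on_linear_solution:
  fixes M :: "'a::real_normed_vector \<Rightarrow> real^'i^'i"
  assumes "open S" "\<And>i j. Ck_on m S (\<lambda>x. M x $ i $ j)" "Ck_on m S b"
    and "\<And>x. x \<in> S \<Longrightarrow> det (M x) \<noteq> 0" "\<And>x. x \<in> S \<Longrightarrow> M x *v s x = b x"
  shows "Ck_on m S s"
proof -
  have s: "s x $ k = det (\<chi> i j. if j = k then b x $ i else M x $ i $ j) / det (M x)" if "x \<in> S" for x k
    using cramer[OF assms(4)[OF that]] assms(5)[OF that] by simp
  show ?thesis
  proof (rule Ck_on_vec[OF assms(1)])
    fix k :: 'i
    have "Ck_on m S (\<lambda>x. (\<chi> i j. if j = k then b x $ i else M x $ i $ j) $ i $ j)" for i j :: 'i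
      using Ck_on_vec_nth[OF assms(1,3)] assms(2) by (cases "j = k") simp_all
    then have "Ck_on m S (\<lambda>x. det (\<chi> i j. if j = k then b x $ i else M x $ i $ j) / det (M x))"
      by (intro Ck_on_divide Ck_on_det assms(1,2,4))
    moreover have "Ck_on m S (\<lambda>x. s x $ k) \<longleftrightarrow>
        Ck_on m S (\<lambda>x. det (\<chi> i j. if j = k then b x $ i else M x $ i $ j) / det (M x))"
      by (rule Ck_on_cong[OF assms(1)]) (rule s)
    ultimately show "Ck_on m S (\<lambda>x. s x $ k)" by blast
  qed
qed

text \<open>The derivative of the inverse solves a linear system whose coefficients have, by induction,
  the regularity of the inverse itself.\<close>

lemma Ck_on_inverse_function:
  fixes f :: "real^'i \<Rightarrow> real^'i"
  assumes Ck: "\<And>m. Ck_on m UNIV f"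
    and inj: "\<And>x v. frechet_derivative f (at x) v = 0 \<Longrightarrow> v = 0"
    and gf: "\<And>x. g (f x) = x" and fg: "\<And>y. f (g y) = y"
  shows "Ck_on m UNIV g"
proof -
  let ?f' = "\<lambda>x. frechet_derivative f (at x)"
  define g' where "g' y = inv (?f' (g y))" for y
  have Df: "(f has_derivative ?f' x) (at x)" for x
    using Ck_on_SucD(1)[OF open_UNIV Ck] by simp
  then have lin: "linear (?f' x)" for x
    using has_derivative_linear by blast
  have bij: "bij (?f' x)" for x
    using inj lin by (metis bijI linear_injective_0 linear_injective_imp_surjective)
  have g': "?f' (g y) (g' y v) = v" for y v
    unfolding g'_def by (meson bij bij_inv_eq_iff)
  have Dg: "(g has_derivative g' y) (at y)" for y
    by (rule has_derivative_inverse_strong_x[of UNIV g y f "?f' (g y)"])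
      (use Df gf fg g' Ck_on_imp_continuous_on[OF Ck] in \<open>auto simp: fun_eq_iff\<close>)
  show ?thesis
  proof (induction m)
    case 0
    show ?case using has_derivative_continuous[OF Dg] by (simp add: continuous_at_imp_continuous_on)
  next
    case (Suc m)
    show ?case
    proof (rule Ck_on_SucI[OF open_UNIV Dg])
      fix v
      let ?M = "\<lambda>y. matrix (?f' (g y))"
      have M: "?M y *v w = ?f' (g y) w" for y w
        using matrix_vector_mul(2)[OF lin] by metis
      show "Ck_on m UNIV (\<lambda>y. g' y v)"
      proof (rule Ck_on_linear_solution[of UNIV m ?M "\<lambda>y. v"])
        show "Ck_on m UNIV (\<lambda>y. ?M y $ i $ j)" for i j
        proof -
          have "Ck_on m UNIV (\<lambda>x. ?f' x (axis j 1))"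
            by (rule Ck_on_SucD(2)[OF open_UNIV Ck])
          from Ck_on_compose[OF open_UNIV open_UNIV _ Suc.IH this]
          have "Ck_on m UNIV (\<lambda>y. ?f' (g y) (axis j 1) $ i)"
            by (intro Ck_on_vec_nth) auto
          then show ?thesis by (simp add: matrix_def)
        qed
        show "det (?M y) \<noteq> 0" for y
        proof -
          have "(*v) (?M y) = ?f' (g y)"
            by (rule ext) (rule M)
          then have "bij ((*v) (?M y))"
            by (simp only: bij)
          then show ?thesis
            unfolding invertible_eq_bij[symmetric] invertible_det_nz .
        qed
      qed (auto simp: M g' Ck_on_const)
    qed
  qed
qed

section \<open>Frames and oriented planes\<close>

lemma bounded_bilinear_matrix_matrix_mult:
  "bounded_bilinear (\<lambda>(A::real^'b^'a) (B::real^'c^'b). A ** B)"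
  unfolding bilinear_conv_bounded_bilinear[symmetric] bilinear_def
  by (auto intro!: linearI simp: matrix_matrix_mult_def vec_eq_iff sum.distrib
      sum_distrib_left algebra_simps)

lemma bounded_bilinear_matrix_vector_mult:
  "bounded_bilinear (\<lambda>(A::real^'b^'a) (x::real^'b). A *v x)"
  unfolding bilinear_conv_bounded_bilinear[symmetric] bilinear_def
  by (auto intro!: linearI simp: matrix_vector_mult_def vec_eq_iff sum.distrib
      sum_distrib_left algebra_simps)

lemmas Ck_on_matrix_mult = Ck_on_bilinear[OF bounded_bilinear_matrix_matrix_mult]
lemmas Ck_on_matrix_vector_mult = Ck_on_bilinear[OF bounded_bilinear_matrix_vector_mult]

lemma orthogonal_comp_Int_eq_0: "x \<in> U \<Longrightarrow> x \<in> orthogonal_comp U \<Longrightarrow> x = 0"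
  by (simp add: orthogonal_comp_def) (use orthogonal_self in blast)

lemma orthogonal_projection_matrix:
  fixes U :: "(real^'n) set"
  assumes U: "subspace U"
  obtains P :: "real^'n^'n" where "\<And>z. P *v z \<in> U" "\<And>z. z - P *v z \<in> orthogonal_comp U"
    "\<And>z. z \<in> U \<Longrightarrow> P *v z = z" "\<And>z. z \<in> orthogonal_comp U \<Longrightarrow> P *v z = 0"
proof -
  obtain B where B: "B \<subseteq> U" "pairwise orthogonal B" "span B = U"
    using orthonormal_basis_subspace[OF U] by metis
  define p where "p z = (\<Sum>b\<in>B. (b \<bullet> z / (b \<bullet> b)) *\<^sub>R b)" for z
  have "linear p"
    unfolding p_def
    by (rule linearI)
      (simp_all add: inner_add_right add_divide_distrib scaleR_add_left sum.distrib scaleR_sum_right)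
  then have P: "matrix p *v z = p z" for z
    using matrix_vector_mul(2)[of p] by metis
  have 1: "p z \<in> U" for z
    unfolding p_def using B U by (auto intro!: subspace_sum subspace_scale)
  have 2: "z - p z \<in> orthogonal_comp U" for z
    unfolding p_def orthogonal_comp_def
    using Gram_Schmidt_step[OF B(2), of _ z] B(3) by auto
  have 3: "p z = z" if "z \<in> U" for z
    using orthogonal_comp_Int_eq_0[OF _ 2[of z]] subspace_diff[OF U that 1[of z]] by simp
  have 4: "p z = 0" if "z \<in> orthogonal_comp U" for z
    using orthogonal_comp_Int_eq_0[OF 1[of z]]
      subspace_diff[OF subspace_orthogonal_comp that 2[of z]] by simp
  show thesis
    by (rule that[of "matrix p"]) (use 1 2 3 4 P in auto)
qed

lemma invertible_matrixE:
  fixes B :: "real^'k^'k"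
  assumes "det B \<noteq> 0"
  obtains C where "B ** C = mat 1" "C ** B = mat 1" "det B * det C = 1"
  using assms invertible_det_nz[of B] unfolding invertible_def by (metis det_I det_mul)

lemma oriented_plane_of_mult:
  fixes M :: "real^'k^'n"
  assumes "det B > 0"
  shows "oriented_plane_of (M ** B) = oriented_plane_of M"
proof -
  obtain C where C: "B ** C = mat 1" "det B * det C = 1"
    using invertible_matrixE[of B] assms by auto
  then have "det C > 0"
    using assms by (metis zero_less_mult_pos zero_less_one)
  moreover have "M ** D = (M ** B) ** (C ** D)" for D
    by (metis C(1) matrix_mul_assoc matrix_mul_rid)
  ultimately have "\<exists>E. M ** D = (M ** B) ** E \<and> det E > 0" if "det D > 0" for D
    using that by (metis det_mul mult_pos_pos)
  moreover have "\<exists>E. (M ** B) ** D = M ** E \<and> det E > 0" if "det D > 0" for D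
    using that assms by (metis det_mul mult_pos_pos matrix_mul_assoc)
  ultimately show ?thesis
    unfolding oriented_plane_of_def by blast
qed

lemma ospan_oriented_plane_of: "ospan (oriented_plane_of M) = range (\<lambda>t. M *v t)"
proof
  show "ospan (oriented_plane_of M) \<subseteq> range (\<lambda>t. M *v t)"
    unfolding ospan_def oriented_plane_of_def by (auto simp: matrix_vector_mul_assoc[symmetric])
  have "M \<in> oriented_plane_of M"
    unfolding oriented_plane_of_def
    by (rule CollectI, rule exI[of _ "mat 1"]) simp
  then show "range (\<lambda>t. M *v t) \<subseteq> ospan (oriented_plane_of M)"
    unfolding ospan_def by blast
qed

section \<open>Graph charts on the oriented Grassmannian\<close>

lemma chart_oriented_plane_of:
  "chart (oriented_plane_of M) L = oriented_plane_of ((mat 1 + L) ** M)"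
  unfolding chart_def oriented_plane_of_def
  by (auto simp: matrix_mul_assoc) (metis matrix_mul_assoc)

lemma OGrE:
  assumes "u \<in> OGr"
  obtains M :: "real^'k^'n" where "u = oriented_plane_of M" "inj (\<lambda>t. M *v t)"
  using assms unfolding OGr_def by blast

lemma subspace_ospan: "u \<in> OGr \<Longrightarrow> subspace (ospan u)"
  by (elim OGrE) (simp add: ospan_oriented_plane_of linear_subspace_image[OF matrix_vector_mul_linear])

lemma ospan_chart:
  fixes u :: "(real^'k^'n) set"
  shows "ospan (chart u L) = (\<lambda>t. t + L *v t) ` ospan u"
proof -
  have *: "((mat 1 + L) ** M) *v t = M *v t + L *v (M *v t)" for M :: "real^'k^'n" and t
    by (simp add: matrix_vector_mul_assoc[symmetric] matrix_vector_mult_add_rdistrib)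
  have "ospan (chart u L) = (\<Union>M\<in>u. range (\<lambda>t. ((mat 1 + L) ** M) *v t))"
    unfolding ospan_def chart_def by blast
  also have "\<dots> = (\<lambda>t. t + L *v t) ` ospan u"
    unfolding * ospan_def by blast
  finally show ?thesis .
qed

lemma Hom_perp_mem:
  assumes "u \<in> OGr" "L \<in> Hom_perp u"
  shows "L *v z \<in> orthogonal_comp (ospan u)"
proof -
  obtain P :: "real^'b^'b" where P: "\<And>z. P *v z \<in> ospan u" "\<And>z. z - P *v z \<in> orthogonal_comp (ospan u)"
    using orthogonal_projection_matrix[OF subspace_ospan[OF assms(1)]] by metis
  have "L *v (z - P *v z) = 0" "L *v (P *v z) \<in> orthogonal_comp (ospan u)"
    using assms(2) P unfolding Hom_perp_def by auto
  then show ?thesis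
    by (simp add: matrix_vector_mult_diff_distrib)
qed

lemma subspace_Hom_perp: "subspace (Hom_perp u)"
  unfolding subspace_def Hom_perp_def
  by (auto simp: matrix_vector_mult_add_rdistrib scaleR_matrix_vector_assoc[symmetric]
      subspace_0 subspace_add subspace_scale subspace_orthogonal_comp)

lemma chart_0: "chart u 0 = u"
  unfolding chart_def by simp

lemma chart_in_OGr:
  assumes "u \<in> OGr" "L \<in> Hom_perp u"
  shows "chart u L \<in> OGr"
proof -
  obtain M where M: "u = oriented_plane_of M" "inj (\<lambda>t. M *v t)"
    using OGrE[OF assms(1)] .
  have "s = 0" if "((mat 1 + L) ** M) *v s = 0" for s
  proof -
    have Ms: "M *v s + L *v (M *v s) = 0"
      using that by (simp add: matrix_vector_mul_assoc[symmetric] matrix_vector_mult_add_rdistrib)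
    have "M *v s \<in> ospan u"
      using M(1) by (simp add: ospan_oriented_plane_of)
    moreover have "M *v s = - (L *v (M *v s))"
      using Ms by (simp add: eq_neg_iff_add_eq_0)
    then have "M *v s \<in> orthogonal_comp (ospan u)"
      using Hom_perp_mem[OF assms] by (metis subspace_neg subspace_orthogonal_comp)
    ultimately have "M *v s = 0"
      by (rule orthogonal_comp_Int_eq_0)
    then show ?thesis
      using M(2) by (metis (mono_tags) injD matrix_vector_mult_0_right)
  qed
  then have "inj (\<lambda>t. ((mat 1 + L) ** M) *v t)"
    by (simp add: linear_injective_0[OF matrix_vector_mul_linear])
  then show ?thesis
    unfolding M(1) chart_oriented_plane_of OGr_def by blast
qed

text \<open>The orthogonal projection of \<open>t + L *v t\<close> to the span of \<open>u\<close>
  is t, so a point of the graph determines its parameter and therefore the value of \<open>L\<close>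
  there; off the span both maps are determined by vanishing on the complement. This is what makes
  the definite description in \<open>chart_inv\<close> meaningful.\<close>

lemma chart_inject:
  assumes u: "u \<in> OGr" and L: "L \<in> Hom_perp u" "L' \<in> Hom_perp u" and eq: "chart u L = chart u L'"
  shows "L = L'"
proof -
  obtain P :: "real^'b^'b" where P: "\<And>z. P *v z \<in> ospan u" "\<And>z. z - P *v z \<in> orthogonal_comp (ospan u)"
    using orthogonal_projection_matrix[OF subspace_ospan[OF u]] by metis
  note sub = subspace_ospan[OF u] and sub' = subspace_orthogonal_comp[of "ospan u"]
  have *: "L *v t = L' *v t" if t: "t \<in> ospan u" for t
  proof -
    have "t + L *v t \<in> (\<lambda>t. t + L' *v t) ` ospan u"
      unfolding ospan_chart[symmetric] eq[symmetric] using t by (simp add: ospan_chart)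
    then obtain s where s: "s \<in> ospan u" "t + L *v t = s + L' *v s" by blast
    then have "t - s = L' *v s - L *v t"
      by (simp add: algebra_simps)
    moreover have "L' *v s - L *v t \<in> orthogonal_comp (ospan u)"
      using Hom_perp_mem[OF u] L by (intro subspace_diff[OF sub'])
    ultimately have "t - s = 0"
      using subspace_diff[OF sub t s(1)] orthogonal_comp_Int_eq_0 by metis
    then show ?thesis using s(2) by simp
  qed
  have "L *v z = L' *v z" for z
  proof -
    have "L *v (z - P *v z) = 0" "L' *v (z - P *v z) = 0"
      using L P unfolding Hom_perp_def by auto
    with *[OF P(1)] show ?thesis
      by (simp add: matrix_vector_mult_diff_distrib)
  qed
  then show ?thesis
    by (simp add: matrix_eq)
qed

lemma chart_eq_self:
  assumes "u \<in> OGr" "L \<in> Hom_perp u" "chart u L = u"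
  shows "L = 0"
  by (rule chart_inject[OF assms(1,2) subspace_0[OF subspace_Hom_perp]]) (simp add: assms(3) chart_0)

lemma chart_inv_chart:
  assumes "u \<in> OGr" "L \<in> Hom_perp u"
  shows "chart_inv u (chart u L) = L"
  unfolding chart_inv_def using assms chart_inject[OF assms(1)] by (intro the_equality) auto

text \<open>\<open>N\<close> is the Moore-Penrose inverse of \<open>M\<close>: an arbitrary left
  inverse preceded by the orthogonal projection onto the range.\<close>

lemma perp_left_inverse:
  fixes M :: "real^'k^'n"
  assumes "inj (\<lambda>t. M *v t)"
  obtains N :: "real^'n^'k" where "N ** M = mat 1"
    "\<And>z. z - M *v (N *v z) \<in> orthogonal_comp (range (\<lambda>t. M *v t))"
    "\<And>z. z \<in> orthogonal_comp (range (\<lambda>t. M *v t)) \<Longrightarrow> N *v z = 0"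
proof -
  let ?U = "range (\<lambda>t. M *v t)"
  have "subspace ?U"
    by (simp add: linear_subspace_image[OF matrix_vector_mul_linear])
  then obtain P :: "real^'n^'n" where P: "\<And>z. P *v z \<in> ?U" "\<And>z. z - P *v z \<in> orthogonal_comp ?U"
    "\<And>z. z \<in> ?U \<Longrightarrow> P *v z = z" "\<And>z. z \<in> orthogonal_comp ?U \<Longrightarrow> P *v z = 0"
    using orthogonal_projection_matrix[of ?U] by metis
  obtain N0 where N0: "N0 ** M = mat 1"
    using assms matrix_left_invertible_injective by metis
  have "P ** M = M"
    using P(3) by (simp add: matrix_eq matrix_vector_mul_assoc[symmetric])
  moreover have "M *v (N0 *v (P *v z)) = P *v z" for z
  proof -
    obtain s where "P *v z = M *v s" using P(1)[of z] by blast
    then show ?thesis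
      by (metis N0 matrix_vector_mul_assoc matrix_vector_mul_lid)
  qed
  ultimately show thesis
    using that[of "N0 ** P"] N0 P(2,4)
    by (simp add: matrix_mul_assoc[symmetric] matrix_vector_mul_assoc[symmetric])
qed

text \<open>Coordinates of the plane framed by X in the chart centered at the plane framed by M;
  here M N is the orthogonal projection onto the range of M.\<close>

lemma frame_in_chart:
  fixes M X :: "real^'k^'n" and N :: "real^'n^'k"
  assumes N: "N ** M = mat 1"
    "\<And>z. z - M *v (N *v z) \<in> orthogonal_comp (range (\<lambda>t. M *v t))"
    "\<And>z. z \<in> orthogonal_comp (range (\<lambda>t. M *v t)) \<Longrightarrow> N *v z = 0"
    and R: "(N ** X) ** R = mat 1" and pos: "det (N ** X) > 0"
  defines "K \<equiv> (X ** R - M) ** N"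
  shows "K \<in> Hom_perp (oriented_plane_of M)"
    and "chart (oriented_plane_of M) K = oriented_plane_of X"
    and "((mat 1 + K) ** M) ** (N ** X) = X"
proof -
  have KM: "K ** M = X ** R - M"
    unfolding K_def by (simp add: matrix_mul_assoc[symmetric] N)
  have "N ** (K ** M) = mat 1 - mat 1"
    unfolding KM using N(1) R
    by (simp add: matrix_mul_assoc bounded_bilinear.diff_right[OF bounded_bilinear_matrix_matrix_mult])
  then have "N *v (K *v (M *v s)) = 0" for s
    by (metis diff_self matrix_vector_mul_assoc matrix_vector_mult_0)
  then have "K *v (M *v s) \<in> orthogonal_comp (range (\<lambda>t. M *v t))" for s
    using N(2)[of "K *v (M *v s)"] by simp
  then show "K \<in> Hom_perp (oriented_plane_of M)"
    unfolding Hom_perp_def ospan_oriented_plane_of using N(3)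
    by (auto simp: K_def matrix_vector_mul_assoc[symmetric])
  have XR: "(mat 1 + K) ** M = X ** R"
    using KM by (simp add: bounded_bilinear.add_left[OF bounded_bilinear_matrix_matrix_mult])
  have "det (N ** X) * det R = 1"
    using R by (metis det_I det_mul)
  then have "det R > 0"
    using pos by (metis zero_less_mult_pos zero_less_one)
  then show "chart (oriented_plane_of M) K = oriented_plane_of X"
    unfolding chart_oriented_plane_of XR by (rule oriented_plane_of_mult)
  have "R ** (N ** X) = mat 1"
    using R matrix_left_right_inverse by blast
  then show "((mat 1 + K) ** M) ** (N ** X) = X"
    unfolding XR by (simp add: matrix_mul_assoc[symmetric])
qed

lemma Ck_on_matrix_right_inverse:
  fixes A R :: "'a::real_normed_vector \<Rightarrow> real^'i^'i"
  assumes S: "open S" and A: "Ck_on m S A" and R: "\<And>x. x \<in> S \<Longrightarrow> A x ** R x = mat 1"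
  shows "Ck_on m S R"
proof -
  have det: "det (A x) \<noteq> 0" if "x \<in> S" for x
    using R[OF that] det_mul[of "A x" "R x"] by auto
  have R': "A x *v (R x *v axis j 1) = axis j 1" if "x \<in> S" for x j
    using R[OF that] by (simp add: matrix_vector_mul_assoc)
  have "Ck_on m S (\<lambda>x. R x *v axis j 1)" for j
    by (rule Ck_on_linear_solution[OF S _ Ck_on_const[OF S] det R'])
      (assumption | intro Ck_on_vec_nth S A)+
  then have "Ck_on m S (\<lambda>x. (R x *v axis j 1) $ i)" for i j
    by (intro Ck_on_vec_nth S)
  moreover have "(R x *v axis j 1) $ i = R x $ i $ j" for x i j
    by (simp add: matrix_vector_mult_basis column_def)
  ultimately show ?thesis
    by (intro Ck_on_vec S) simp
qed

text \<open>Where \<open>N ** X y\<close> has positive determinant, the frame can be renormalised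
  without changing its oriented plane so that its projection becomes \<open>X x\<close>; subtracting
  \<open>X x\<close> leaves the chart coordinate. The normalising matrix is smooth by Cramer's rule.
  The factorisation of \<open>X y\<close> is recorded because it can be differentiated at x.\<close>

lemma smooth_frame_in_chart:
  fixes X :: "real^'n \<Rightarrow> real^'k^'n"
  assumes X: "\<And>m. Ck_on m UNIV X" and inj: "inj (\<lambda>t. X x *v t)"
  obtains V K N where "open V" "x \<in> V" "smooth_on V K"
    "\<And>y. y \<in> V \<Longrightarrow> K y \<in> Hom_perp (oriented_plane_of (X x))"
    "\<And>y. y \<in> V \<Longrightarrow> chart (oriented_plane_of (X x)) (K y) = oriented_plane_of (X y)"
    "\<And>y. y \<in> V \<Longrightarrow> ((mat 1 + K y) ** X x) ** (N ** X y) = X y"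
    "N ** X x = mat 1"
proof -
  obtain N :: "real^'n^'k" where N: "N ** X x = mat 1"
    "\<And>z. z - X x *v (N *v z) \<in> orthogonal_comp (range (\<lambda>t. X x *v t))"
    "\<And>z. z \<in> orthogonal_comp (range (\<lambda>t. X x *v t)) \<Longrightarrow> N *v z = 0"
    using perp_left_inverse[OF inj] by metis
  have NX: "Ck_on m UNIV (\<lambda>y. N ** X y)" for m
    by (intro Ck_on_matrix_mult Ck_on_const X open_UNIV)
  define V where "V = {y. det (N ** X y) > 0}"
  have "continuous_on UNIV (\<lambda>y. det (N ** X y))"
    by (rule Ck_on_imp_continuous_on[of 0]) (intro Ck_on_det Ck_on_vec_nth NX open_UNIV)
  then have V: "open V" "x \<in> V"
    unfolding V_def by (auto simp: N open_Collect_less)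
  have "\<exists>R. (N ** X y) ** R = mat 1" if "y \<in> V" for y
    using that invertible_matrixE[of "N ** X y"] unfolding V_def by (metis less_irrefl mem_Collect_eq)
  then obtain R where R: "\<And>y. y \<in> V \<Longrightarrow> (N ** X y) ** R y = mat 1"
    by metis
  have CR: "Ck_on m V R" for m
    by (rule Ck_on_matrix_right_inverse[OF V(1) Ck_on_subset[OF open_UNIV _ NX] R]) auto
  define K where "K y = (X y ** R y - X x) ** N" for y
  show thesis
  proof (rule that[of V K N])
    show "smooth_on V K"
      unfolding smooth_on_def K_def
      by (intro allI Ck_on_matrix_mult Ck_on_diff Ck_on_const V CR Ck_on_subset[OF open_UNIV _ X]) auto
    fix y assume y: "y \<in> V"
    then have "det (N ** X y) > 0" by (simp add: V_def)
    note * = frame_in_chart[OF N R[OF y] this]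
    show "K y \<in> Hom_perp (oriented_plane_of (X x))"
      "chart (oriented_plane_of (X x)) (K y) = oriented_plane_of (X y)"
      "((mat 1 + K y) ** X x) ** (N ** X y) = X y"
      unfolding K_def using * by auto
  qed (use V N in auto)
qed

section \<open>Smoothness and nondegeneracy read off from a frame\<close>

lemma smooth_on_differentiable:
  assumes "open S" "smooth_on S f" "x \<in> S"
  shows "(f has_derivative frechet_derivative f (at x)) (at x)"
  using Ck_on_SucD(1)[OF assms(1) _ assms(3)] assms(2) unfolding smooth_on_def by blast

text \<open>The derivative within a slice is an arbitrary choice among many linear maps, since
  nothing fixes it in directions transverse to the slice. Along a direction \<xi> of the slice it is
  determined: restriction to the line through x in direction \<xi> reduces to a function of one real
  variable, whose derivative is unique.\<close>

lemma frechet_derivative_slice: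
  fixes f :: "'a::real_normed_vector \<Rightarrow> 'b::real_normed_vector"
  assumes f: "(f has_derivative f') (at x)" and T: "open T" "x \<in> T"
    and S: "subspace S" "\<xi> \<in> S"
  shows "frechet_derivative f (at x within ({x + \<xi> | \<xi>. \<xi> \<in> S} \<inter> T)) \<xi> = f' \<xi>"
proof -
  let ?A = "{x + \<xi> | \<xi>. \<xi> \<in> S} \<inter> T" and ?l = "\<lambda>s::real. x + s *\<^sub>R \<xi>"
  define g where "g = frechet_derivative f (at x within ?A)"
  have g: "(f has_derivative g) (at x within ?A)"
    unfolding g_def using differentiableI[OF has_derivative_at_withinI[OF f]] frechet_derivative_works by blast
  have l: "(?l has_derivative (\<lambda>s. s *\<^sub>R \<xi>)) (at 0 within B)" for B
    by (auto intro!: derivative_eq_intros)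
  define B where "B = ?l -` T"
  have B: "open B" "0 \<in> B"
    unfolding B_def using T by (auto intro!: open_vimage continuous_on_add continuous_on_scaleR
        continuous_on_const continuous_on_id)
  have "?l ` B \<subseteq> ?A"
    unfolding B_def using S by (auto intro: subspace_scale)
  then have "(f has_derivative g) (at (?l 0) within ?l ` B)"
    using has_derivative_subset[OF g] by simp
  from has_derivative_in_compose[OF l this]
  have "((\<lambda>s. f (?l s)) has_derivative (\<lambda>s. g (s *\<^sub>R \<xi>))) (at 0 within B)" .
  then have "((\<lambda>s. f (?l s)) has_derivative (\<lambda>s. g (s *\<^sub>R \<xi>))) (at 0)"
    by (simp only: at_within_open[OF B(2,1)])
  moreover have "((\<lambda>s. f (?l s)) has_derivative (\<lambda>s. f' (s *\<^sub>R \<xi>))) (at 0)"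
    by (rule has_derivative_compose[OF l]) (simp add: f)
  ultimately have "(\<lambda>s. g (s *\<^sub>R \<xi>)) = (\<lambda>s. f' (s *\<^sub>R \<xi>))"
    by (rule has_derivative_unique)
  from fun_cong[OF this, of 1] show ?thesis by (simp add: g_def)
qed

text \<open>Modulo the range of \<open>X x\<close>, the derivative of the frame applied to s equals
  the derivative of the chart coordinate applied to \<open>t = X x *v s\<close>. So nondegeneracy
  says that moving transversally carries no nonzero vector of the frame to first order inside the
  plane, a condition free of \<open>chart_inv\<close>.\<close>

lemma smooth_nondegenerate_frame:
  fixes X :: "real^'n \<Rightarrow> real^'k^'n"
  assumes X: "\<And>m. Ck_on m UNIV X" and inj: "\<And>x. inj (\<lambda>t. X x *v t)"
    and nd: "\<And>x \<xi> s. \<xi> \<in> orthogonal_comp (range (\<lambda>t. X x *v t)) \<Longrightarrow> \<xi> \<noteq> 0 \<Longrightarrow> s \<noteq> 0 \<Longrightarrow>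
      frechet_derivative X (at x) \<xi> *v s \<notin> range (\<lambda>t. X x *v t)"
  shows "smooth_plane_map UNIV (\<lambda>x. oriented_plane_of (X x))"
    and "nondegenerate UNIV (\<lambda>x. oriented_plane_of (X x))"
proof -
  let ?p = "\<lambda>x. oriented_plane_of (X x)"
  have OGr: "?p x \<in> OGr" for x
    unfolding OGr_def using inj by blast
  have key: "\<exists>V K N. open V \<and> x \<in> V \<and> smooth_on V K \<and> N ** X x = mat 1 \<and>
      (\<forall>y\<in>V. K y \<in> Hom_perp (?p x) \<and> chart (?p x) (K y) = ?p y \<and> chart_inv (?p x) (?p y) = K y \<and>
        ((mat 1 + K y) ** X x) ** (N ** X y) = X y)" for x
    using smooth_frame_in_chart[OF X inj[of x]] chart_inv_chart[OF OGr[of x]] by metis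
  have smooth: "smooth_on V (\<lambda>y. chart_inv (?p x) (?p y))"
    if "open V" "smooth_on V K" "\<And>y. y \<in> V \<Longrightarrow> chart_inv (?p x) (?p y) = K y" for V K x
    using that(2) Ck_on_cong[OF that(1), where g=K, OF that(3)] unfolding smooth_on_def by auto
  show "smooth_plane_map UNIV ?p"
    unfolding smooth_plane_map_def
  proof
    fix x
    obtain V K where V: "open V" "x \<in> V" "smooth_on V K" and
      K: "\<And>y. y \<in> V \<Longrightarrow> K y \<in> Hom_perp (?p x)" "\<And>y. y \<in> V \<Longrightarrow> chart (?p x) (K y) = ?p y"
      "\<And>y. y \<in> V \<Longrightarrow> chart_inv (?p x) (?p y) = K y"
      using key[of x] by blast
    have "\<forall>y\<in>V. ?p y \<in> chart (?p x) ` Hom_perp (?p x)"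
      using K(1,2) by (metis imageI)
    moreover have "smooth_on V (\<lambda>y. chart_inv (?p x) (?p y))"
      by (rule smooth[OF V(1,3) K(3)])
    ultimately show "\<exists>U. open U \<and> x \<in> U \<and> U \<subseteq> UNIV \<and>
        (\<forall>y\<in>U. ?p y \<in> chart (?p x) ` Hom_perp (?p x)) \<and>
        smooth_on U (\<lambda>y. chart_inv (?p x) (?p y))"
      using V by blast
  qed
  show "nondegenerate UNIV ?p"
    unfolding nondegenerate_def Let_def
  proof (intro ballI impI)
    fix x \<xi> t
    assume \<xi>: "\<xi> \<in> orthogonal_comp (ospan (?p x))" "\<xi> \<noteq> 0" and t: "t \<in> ospan (?p x)" "t \<noteq> 0"
    obtain V K N where V: "open V" "x \<in> V" "smooth_on V K" and N: "N ** X x = mat 1" and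
      K: "\<And>y. y \<in> V \<Longrightarrow> K y \<in> Hom_perp (?p x) \<and> chart (?p x) (K y) = ?p y \<and>
        chart_inv (?p x) (?p y) = K y \<and> ((mat 1 + K y) ** X x) ** (N ** X y) = X y"
      using key[of x] by blast
    let ?K' = "frechet_derivative K (at x)" and ?X' = "frechet_derivative X (at x)"
    have DK: "(K has_derivative ?K') (at x)"
      by (rule smooth_on_differentiable[OF V(1,3,2)])
    have DX: "(X has_derivative ?X') (at x)"
      using Ck_on_SucD(1)[OF open_UNIV X] by simp
    have "((\<lambda>y. chart_inv (?p x) (?p y)) has_derivative ?K') (at x)"
      by (rule has_derivative_transform_within_open[OF DK V(1,2)]) (use K in auto)
    then have D: "frechet_derivative (\<lambda>y. chart_inv (?p x) (?p y))
        (at x within ({x + \<xi> | \<xi>. \<xi> \<in> orthogonal_comp (ospan (?p x))} \<inter> UNIV)) \<xi> = ?K' \<xi>"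
      by (rule frechet_derivative_slice) (auto simp: \<xi> subspace_orthogonal_comp)
    \<comment> \<open>The chart is centered at x. With \<open>K x = 0\<close> and
      \<open>N ** X x = mat 1\<close>, the product rule for the factorisation of \<open>X\<close>
      collapses to the identity \<open>X'\<close> below.\<close>
    have "K x = 0"
      using K[OF V(2)] chart_eq_self[OF OGr] by blast
    note prod = bounded_bilinear.FDERIV[OF bounded_bilinear_matrix_matrix_mult]
    have "((\<lambda>y. ((mat 1 + K y) ** X x) ** (N ** X y)) has_derivative
        (\<lambda>v. ((mat 1 + K x) ** X x) ** (N ** ?X' v + 0 ** X x) +
          ((mat 1 + K x) ** 0 + (0 + ?K' v) ** X x) ** (N ** X x))) (at x)"
      by (intro prod has_derivative_add has_derivative_const DK DX)
    then have "(X has_derivative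
        (\<lambda>v. ((mat 1 + K x) ** X x) ** (N ** ?X' v + 0 ** X x) +
          ((mat 1 + K x) ** 0 + (0 + ?K' v) ** X x) ** (N ** X x))) (at x)"
      by (rule has_derivative_transform_within_open[OF _ V(1,2)]) (use K in auto)
    from has_derivative_unique[OF this DX]
    have X': "X x ** (N ** ?X' v) + ?K' v ** X x = ?X' v" for v
      unfolding fun_eq_iff using \<open>K x = 0\<close> N
      by (simp add: bounded_bilinear.zero_left[OF bounded_bilinear_matrix_matrix_mult]
          bounded_bilinear.zero_right[OF bounded_bilinear_matrix_matrix_mult])
    obtain s where s: "t = X x *v s"
      using t(1) by (auto simp: ospan_oriented_plane_of)
    with t(2) have "s \<noteq> 0" by auto
    have "?K' \<xi> *v t \<noteq> 0"
    proof
      assume "?K' \<xi> *v t = 0"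
      then have "?X' \<xi> *v s = X x *v (N *v (?X' \<xi> *v s))"
        using arg_cong[OF X'[of \<xi>], of "\<lambda>A. A *v s"]
        by (simp add: s matrix_vector_mult_add_rdistrib matrix_vector_mul_assoc)
      then show False
        using nd[of \<xi> x s] \<xi> \<open>s \<noteq> 0\<close> by (auto simp: ospan_oriented_plane_of)
    qed
    with D show "frechet_derivative (\<lambda>y. chart_inv (?p x) (?p y))
        (at x within ({x + \<xi> | \<xi>. \<xi> \<in> orthogonal_comp (ospan (?p x))} \<inter> UNIV)) \<xi> *v t \<noteq> 0"
      by simp
  qed
qed

section \<open>Cutting off the nonlinear part\<close>

lemma poly_times_exp_minus_tendsto_0:
  "((\<lambda>y::real. poly p y * exp (- y)) \<longlongrightarrow> 0) at_top"
proof -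
  have "((\<lambda>y::real. \<Sum>i\<le>degree p. coeff p i * (y ^ i / exp y)) \<longlongrightarrow> (\<Sum>i\<le>degree p. coeff p i * 0)) at_top"
    by (intro tendsto_sum tendsto_mult tendsto_const tendsto_power_div_exp_0)
  then show ?thesis
    by (simp add: poly_altdef sum_distrib_right exp_minus divide_inverse mult.assoc)
qed

text \<open>The factor p(1/x) is carried along so that the family is closed under differentiation: p
  turns into X^2 (p - p'). Smoothness of the flat function exp(-1/x) then follows by induction over
  all p at once.\<close>

definition flat_exp :: "real poly \<Rightarrow> real \<Rightarrow> real" where
  "flat_exp p x = (if x > 0 then poly p (inverse x) * exp (- inverse x) else 0)"

lemma flat_exp_tendsto_0: "(flat_exp p \<longlongrightarrow> 0) (at_right 0)"
proof -
  have "((\<lambda>x. poly p (inverse x) * exp (- inverse x)) \<longlongrightarrow> 0) (at_right (0::real))"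
    by (rule filterlim_compose[OF poly_times_exp_minus_tendsto_0 filterlim_inverse_at_top_right])
  moreover have "eventually (\<lambda>x. poly p (inverse x) * exp (- inverse x) = flat_exp p x) (at_right (0::real))"
    unfolding eventually_at_right_field flat_exp_def by (auto intro: exI[of _ 1])
  ultimately show ?thesis
    by (rule Lim_transform_eventually)
qed

lemma flat_exp_has_derivative:
  "(flat_exp p has_real_derivative flat_exp (monom 1 2 * (p - pderiv p)) x) (at x)"
proof -
  consider "x > 0" | "x < 0" | "x = 0" by linarith
  then show ?thesis
  proof cases
    case 1
    have "((\<lambda>x. poly p (inverse x) * exp (- inverse x)) has_real_derivative
        flat_exp (monom 1 2 * (p - pderiv p)) x) (at x)"
      using 1 unfolding flat_exp_def
      by (auto intro!: derivative_eq_intros DERIV_chain2[OF poly_DERIV]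
          simp: poly_monom algebra_simps power2_eq_square)
    then show ?thesis
      by (rule has_field_derivative_transform_within_open[of _ _ _ "{0<..}"])
        (use 1 in \<open>auto simp: flat_exp_def\<close>)
  next
    case 2
    have "((\<lambda>x. 0) has_real_derivative flat_exp (monom 1 2 * (p - pderiv p)) x) (at x)"
      using 2 unfolding flat_exp_def by auto
    then show ?thesis
      by (rule has_field_derivative_transform_within_open[of _ _ _ "{..<0}"])
        (use 2 in \<open>auto simp: flat_exp_def\<close>)
  next
    case 3
    have "((\<lambda>h. flat_exp p h / h) \<longlongrightarrow> 0) (at_left 0)"
    proof (rule Lim_transform_eventually[OF tendsto_const])
      show "eventually (\<lambda>h. 0 = flat_exp p h / h) (at_left 0)"
        unfolding eventually_at_left_field flat_exp_def by (auto intro: exI[of _ "-1"])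
    qed
    \<comment> \<open>Dividing by h multiplies the polynomial in 1/h by its variable, so the
      quotient is again a member of the family and tends to 0.\<close>
    moreover have "((\<lambda>h. flat_exp p h / h) \<longlongrightarrow> 0) (at_right 0)"
    proof (rule Lim_transform_eventually[OF flat_exp_tendsto_0])
      show "eventually (\<lambda>h. flat_exp (pCons 0 p) h = flat_exp p h / h) (at_right 0)"
        unfolding eventually_at_right_field flat_exp_def
        by (auto intro!: exI[of _ 1] simp: divide_inverse)
    qed
    ultimately have "((\<lambda>h. flat_exp p h / h) \<longlongrightarrow> 0) (at 0)"
      by (rule filterlim_split_at)
    then show ?thesis
      using 3 by (simp add: DERIV_def flat_exp_def)
  qed
qed

lemma Ck_on_flat_exp: "Ck_on m UNIV (flat_exp p)"
proof (induction m arbitrary: p)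
  case 0
  have "isCont (flat_exp p) x" for x
    using flat_exp_has_derivative DERIV_isCont by blast
  then show ?case by (simp add: continuous_at_imp_continuous_on)
next
  case (Suc m)
  show ?case
    by (rule Ck_on_SucI[OF open_UNIV flat_exp_has_derivative[unfolded has_field_derivative_def]])
      (intro Ck_on_mult Suc.IH Ck_on_const open_UNIV)
qed

text \<open>The numbers 1 - s and s - 1/4 are never both nonpositive, so the denominator of the
  quotient is positive. The cutoff will be evaluated at |y|^2 / \<epsilon>^2, which is smooth at the
  origin, unlike the norm; the threshold 1/4 corresponds to |y| = \<epsilon>/2.\<close>

lemma smooth_cutoff:
  obtains \<phi> :: "real \<Rightarrow> real" where "\<And>m. Ck_on m UNIV \<phi>" "\<And>s. s \<le> 1/4 \<Longrightarrow> \<phi> s = 1"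
    "\<And>s. s \<ge> 1 \<Longrightarrow> \<phi> s = 0" "\<And>s. 0 \<le> \<phi> s" "\<And>s. \<phi> s \<le> 1"
proof -
  let ?e = "flat_exp 1"
  have e: "?e x \<ge> 0" "?e x > 0 \<longleftrightarrow> x > 0" "?e x = 0 \<longleftrightarrow> x \<le> 0" for x
    by (auto simp: flat_exp_def)
  define \<phi> where "\<phi> s = ?e (1 - s) / (?e (1 - s) + ?e (s - 1/4))" for s
  have pos: "?e (1 - s) + ?e (s - 1/4) > 0" for s
    using e(1,2)[of "1 - s"] e(1,2)[of "s - 1/4"]
    by (cases "s < 1") (auto intro: add_pos_nonneg add_nonneg_pos)
  have C: "Ck_on m UNIV (\<lambda>s. ?e (f s))" if "Ck_on m UNIV f" for f and m
    by (rule Ck_on_compose[OF open_UNIV open_UNIV _ that Ck_on_flat_exp]) simp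
  have "Ck_on m UNIV \<phi>" for m
    unfolding \<phi>_def
    by (intro Ck_on_divide Ck_on_add C Ck_on_diff Ck_on_const Ck_on_id open_UNIV) (use pos in \<open>simp add: less_imp_neq[symmetric]\<close>)
  moreover have "\<phi> s = 1" if "s \<le> 1/4" for s
    using that e(3)[of "s - 1/4"] e(3)[of "1 - s"] unfolding \<phi>_def by simp
  moreover have "\<phi> s = 0" if "s \<ge> 1" for s
    using that e(3)[of "1 - s"] unfolding \<phi>_def by simp
  moreover have "0 \<le> \<phi> s" "\<phi> s \<le> 1" for s
    using e(1)[of "1 - s"] e(1)[of "s - 1/4"] pos[of s] unfolding \<phi>_def by (auto simp: divide_simps)
  ultimately show thesis using that by blast
qed

text \<open>Being C^1 here gives continuity of the derivative in each fixed direction; the sum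
  \<open>F\<close> over a basis turns this into a bound on the operator norm. The estimate for B
  itself is the mean value inequality for B minus its linear part, on a ball.\<close>

lemma linear_approximation_near_0:
  fixes B :: "'a::euclidean_space \<Rightarrow> 'b::euclidean_space"
  assumes r: "r > 0" and B: "\<And>m. Ck_on m (ball 0 r) B" and "B 0 = 0" and \<eta>: "\<eta> > 0"
  obtains \<rho> where "0 < \<rho>" "\<rho> < r"
    "\<And>y v. norm y \<le> \<rho> \<Longrightarrow>
      norm (frechet_derivative B (at y) v - frechet_derivative B (at 0) v) \<le> \<eta> * norm v"
    "\<And>y. norm y \<le> \<rho> \<Longrightarrow> norm (B y - frechet_derivative B (at 0) y) \<le> \<eta> * norm y"
proof -
  let ?B' = "\<lambda>y. frechet_derivative B (at y)"
  have DB: "(B has_derivative ?B' y) (at y)" if "norm y < r" for y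
    using Ck_on_SucD(1)[OF _ B] that by auto
  have lin: "linear (?B' y)" if "norm y < r" for y
    using DB[OF that] has_derivative_linear by blast
  define F where "F y = (\<Sum>b\<in>Basis. norm (?B' y b - ?B' 0 b))" for y
  have "continuous_on (ball 0 r) (\<lambda>y. ?B' y b)" for b
    by (rule Ck_on_imp_continuous_on[OF Ck_on_SucD(2)[OF open_ball B]])
  then have "continuous_on (ball 0 r) F"
    unfolding F_def by (intro continuous_on_sum continuous_on_norm continuous_on_diff continuous_on_const)
  then have "isCont F 0"
    using r by (simp add: continuous_on_eq_continuous_at)
  moreover have "F 0 = 0" by (simp add: F_def)
  ultimately obtain d where d: "d > 0" "\<And>y. norm y < d \<Longrightarrow> F y < \<eta>"
    using \<eta> unfolding continuous_at_eps_delta by (force simp: dist_norm)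
  define \<rho> where "\<rho> = min d r / 2"
  have \<rho>: "0 < \<rho>" "\<rho> < r" "\<rho> < d"
    using d(1) r by (auto simp: \<rho>_def)
  have 1: "norm (?B' y v - ?B' 0 v) \<le> \<eta> * norm v" if y: "norm y \<le> \<rho>" for y v
  proof -
    let ?L = "\<lambda>v. ?B' y v - ?B' 0 v"
    have L: "linear ?L"
      using lin[of y] lin[of 0] y \<rho> r by (intro linear_compose_sub) auto
    have "?L v = (\<Sum>b\<in>Basis. (v \<bullet> b) *\<^sub>R ?L b)"
      using linear_sum[OF L, of "\<lambda>b. (v \<bullet> b) *\<^sub>R b" Basis]
      by (simp add: euclidean_representation linear_scale[OF L])
    also have "norm \<dots> \<le> (\<Sum>b\<in>Basis. norm v * norm (?L b))"
      by (rule sum_norm_le) (simp add: Basis_le_norm mult_right_mono)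
    also have "\<dots> = norm v * F y"
      by (simp add: F_def sum_distrib_left)
    also have "\<dots> \<le> norm v * \<eta>"
      using d(2)[of y] y \<rho> by (intro mult_left_mono) auto
    finally show ?thesis by (simp add: mult.commute)
  qed
  have 2: "norm (B y - ?B' 0 y) \<le> \<eta> * norm y" if y: "norm y \<le> \<rho>" for y
  proof -
    have L0: "linear (?B' 0)" using lin r by simp
    have "norm ((B y - ?B' 0 y) - (B 0 - ?B' 0 0)) \<le> \<eta> * norm (y - 0)"
    proof (rule differentiable_bound[of "cball 0 \<rho>" _ "\<lambda>y v. ?B' y v - ?B' 0 v"])
      fix x :: 'a assume "x \<in> cball 0 \<rho>"
      then have x: "norm x \<le> \<rho>" by simp
      show "((\<lambda>y. B y - ?B' 0 y) has_derivative (\<lambda>v. ?B' x v - ?B' 0 v)) (at x within cball 0 \<rho>)"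
        using DB[of x] x \<rho> L0
        by (intro has_derivative_diff linear_imp_has_derivative) (auto intro: has_derivative_at_withinI)
      show "onorm (\<lambda>v. ?B' x v - ?B' 0 v) \<le> \<eta>"
        using 1[OF x] \<eta> by (intro onorm_bound) auto
    qed (use y \<rho> in auto)
    then show ?thesis
      by (simp add: assms(3) linear_0[OF L0])
  qed
  show thesis
    using that[OF \<rho>(1,2) 1 2] by blast
qed

text \<open>The last two conclusions are there so that \<open>H\<close> stays in every linear
  subspace containing the values of the remainder: each value is a multiple of a remainder value or
  zero. In the application that subspace is \<open>Hom_perp u\<close>.\<close>

lemma cutoff_remainder:
  fixes B :: "'a::euclidean_space \<Rightarrow> 'b::euclidean_space"
  assumes r: "r > 0" and B: "\<And>m. Ck_on m (ball 0 r) B" and "B 0 = 0" and \<delta>: "\<delta> > 0"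
  obtains \<epsilon> H where "0 < \<epsilon>" "\<epsilon> < r" "\<And>m. Ck_on m UNIV H"
    "\<And>y. norm y < \<epsilon> / 2 \<Longrightarrow> H y = B y - frechet_derivative B (at 0) y"
    "\<And>y v. norm (frechet_derivative H (at y) v) \<le> \<delta> * norm v"
    "\<And>y. norm y < r \<Longrightarrow> \<exists>c. H y = c *\<^sub>R (B y - frechet_derivative B (at 0) y)"
    "\<And>y. norm y \<ge> r \<Longrightarrow> H y = 0"
proof -
  let ?B' = "\<lambda>y. frechet_derivative B (at y)"
  obtain \<phi> :: "real \<Rightarrow> real" where \<phi>: "\<And>m. Ck_on m UNIV \<phi>" "\<And>s. s \<le> 1/4 \<Longrightarrow> \<phi> s = 1"
    "\<And>s. s \<ge> 1 \<Longrightarrow> \<phi> s = 0" "\<And>s. 0 \<le> \<phi> s" "\<And>s. \<phi> s \<le> 1"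
    using smooth_cutoff by metis
  let ?\<phi>' = "\<lambda>s. frechet_derivative \<phi> (at s)"
  have D\<phi>: "(\<phi> has_derivative ?\<phi>' s) (at s)" for s
    using Ck_on_SucD(1)[OF open_UNIV \<phi>(1)] by simp
  have "continuous_on {0..1} (\<lambda>s. ?\<phi>' s 1)"
    by (rule continuous_on_subset[OF Ck_on_imp_continuous_on[OF Ck_on_SucD(2)[OF open_UNIV \<phi>(1)]]]) simp
  then have "bounded ((\<lambda>s. ?\<phi>' s 1) ` {0..1})"
    by (rule compact_imp_bounded[OF compact_continuous_image[OF _ compact_Icc]])
  then obtain M where M: "M > 0" "\<And>s. s \<in> {0..1} \<Longrightarrow> norm (?\<phi>' s 1) \<le> M"
    unfolding bounded_pos by blast
  have M': "\<bar>?\<phi>' s h\<bar> \<le> M * \<bar>h\<bar>" if "s \<in> {0..1}" for s h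
  proof -
    have "?\<phi>' s (h *\<^sub>R 1) = h *\<^sub>R ?\<phi>' s 1"
      using linear_scale[OF has_derivative_linear[OF D\<phi>]] .
    then have "\<bar>?\<phi>' s h\<bar> = \<bar>h\<bar> * \<bar>?\<phi>' s 1\<bar>" by (simp add: abs_mult)
    also have "\<dots> \<le> \<bar>h\<bar> * M"
      using M(2)[OF that] by (intro mult_left_mono) auto
    finally show ?thesis by (simp add: mult.commute)
  qed
  \<comment> \<open>The product rule has two terms. The cutoff times the derivative of the remainder
    contributes \<eta>; the derivative of the cutoff, at most M * 2/\<epsilon>, times the remainder,
    at most \<eta> * \<epsilon>, contributes 2 M \<eta>.\<close>
  define \<eta> where "\<eta> = \<delta> / (2 * M + 1)"
  have \<eta>: "\<eta> > 0" "(2 * M + 1) * \<eta> = \<delta>"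
    using \<delta> M(1) by (auto simp: \<eta>_def)
  obtain \<epsilon> where \<epsilon>: "0 < \<epsilon>" "\<epsilon> < r"
    and d1: "\<And>y v. norm y \<le> \<epsilon> \<Longrightarrow> norm (?B' y v - ?B' 0 v) \<le> \<eta> * norm v"
    and d0: "\<And>y. norm y \<le> \<epsilon> \<Longrightarrow> norm (B y - ?B' 0 y) \<le> \<eta> * norm y"
    using linear_approximation_near_0[OF r B assms(3) \<eta>(1)] by metis
  have DB: "(B has_derivative ?B' y) (at y)" if "norm y < r" for y
    using Ck_on_SucD(1)[OF _ B] that by auto
  have bl: "bounded_linear (?B' 0)"
    using DB[of 0] r has_derivative_bounded_linear by auto
  let ?s = "\<lambda>y::'a. (y \<bullet> y) / \<epsilon>\<^sup>2"
  define H where "H y = \<phi> (?s y) *\<^sub>R (B y - ?B' 0 y)" for y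
  have s_ge: "?s y \<ge> 1 \<longleftrightarrow> norm y \<ge> \<epsilon>" for y
    using \<epsilon>(1) by (simp add: dot_square_norm power_mono_iff divide_simps)
  have H0: "H y = 0" if "norm y \<ge> \<epsilon>" for y
    using that s_ge \<phi>(3) unfolding H_def by simp
  have Cs: "Ck_on m UNIV (\<lambda>y. \<phi> (?s y))" for m
    by (rule Ck_on_compose[OF open_UNIV open_UNIV _ _ \<phi>(1)])
      (auto intro!: Ck_on_divide Ck_on_inner Ck_on_id Ck_on_const simp: \<epsilon>(1)[THEN less_imp_neq, symmetric])
  \<comment> \<open>The ball of radius r, where B is smooth, and the exterior of the closed ball of
    radius \<epsilon>, where \<open>H\<close> vanishes, cover the space because \<epsilon> <
    r.\<close>
  have CH: "Ck_on m UNIV H" for m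
  proof (rule Ck_on_local)
    fix x :: 'a
    show "\<exists>U. open U \<and> x \<in> U \<and> Ck_on m U H"
    proof (cases "norm x < r")
      case True
      have "Ck_on m (ball 0 r) H"
        unfolding H_def
        by (intro Ck_on_scaleR Ck_on_diff Ck_on_subset[OF open_UNIV _ Cs] B Ck_on_bounded_linear[OF _ bl]) auto
      then show ?thesis using True by (intro exI[of _ "ball 0 r"]) auto
    next
      case False
      have op: "open (- cball (0::'a) \<epsilon>)" by auto
      have "Ck_on m (- cball 0 \<epsilon>) H \<longleftrightarrow> Ck_on m (- cball 0 \<epsilon>) (\<lambda>x::'a. 0 :: 'b)"
        by (rule Ck_on_cong[OF op]) (simp add: H0)
      then show ?thesis
        using False \<epsilon> op Ck_on_const[OF op] by (intro exI[of _ "- cball 0 \<epsilon>"]) auto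
    qed
  qed
  have DH: "norm (frechet_derivative H (at y) v) \<le> \<delta> * norm v" for y v
  proof (cases "norm y \<le> \<epsilon>")
    case True
    then have y: "norm y < r" using \<epsilon> by simp
    have ss: "?s y \<in> {0..1}"
      using True \<epsilon>(1) by (simp add: dot_square_norm power_mono divide_simps)
    have "((\<lambda>y. y \<bullet> y) has_derivative (\<lambda>v. 2 * (y \<bullet> v))) (at y)"
      by (auto intro!: derivative_eq_intros simp: inner_commute)
    then have Ds: "(?s has_derivative (\<lambda>v. 2 * (y \<bullet> v) / \<epsilon>\<^sup>2)) (at y)"
      by (rule bounded_linear.has_derivative[OF bounded_linear_divide])
    have "(H has_derivative (\<lambda>v. \<phi> (?s y) *\<^sub>R (?B' y v - ?B' 0 v) +
        ?\<phi>' (?s y) (2 * (y \<bullet> v) / \<epsilon>\<^sup>2) *\<^sub>R (B y - ?B' 0 y))) (at y)"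
      unfolding H_def
      by (rule has_derivative_scaleR[OF has_derivative_compose[OF Ds D\<phi>]
          has_derivative_diff[OF DB[OF y] bounded_linear_imp_has_derivative[OF bl]]])
    from fun_cong[OF frechet_derivative_at[OF this, symmetric], of v]
    have "frechet_derivative H (at y) v = \<phi> (?s y) *\<^sub>R (?B' y v - ?B' 0 v) +
        ?\<phi>' (?s y) (2 * (y \<bullet> v) / \<epsilon>\<^sup>2) *\<^sub>R (B y - ?B' 0 y)"
      .
    also have "norm \<dots> \<le> norm (\<phi> (?s y) *\<^sub>R (?B' y v - ?B' 0 v)) +
        norm (?\<phi>' (?s y) (2 * (y \<bullet> v) / \<epsilon>\<^sup>2) *\<^sub>R (B y - ?B' 0 y))"
      by (rule norm_triangle_ineq)
    also have "norm (\<phi> (?s y) *\<^sub>R (?B' y v - ?B' 0 v)) \<le> 1 * (\<eta> * norm v)"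
      unfolding norm_scaleR using \<phi>(4,5)[of "?s y"] by (intro mult_mono d1[OF True]) auto
    also have "norm (?\<phi>' (?s y) (2 * (y \<bullet> v) / \<epsilon>\<^sup>2) *\<^sub>R (B y - ?B' 0 y)) \<le> (2 * M * \<eta>) * norm v"
    proof -
      have "\<bar>y \<bullet> v\<bar> \<le> norm v * \<epsilon>"
        using Cauchy_Schwarz_ineq2[of v y] mult_left_mono[OF True norm_ge_zero[of v]]
        by (simp add: inner_commute)
      then have "\<bar>2 * (y \<bullet> v) / \<epsilon>\<^sup>2\<bar> \<le> 2 * norm v / \<epsilon>"
        using \<epsilon>(1) by (simp add: abs_mult divide_simps power2_eq_square mult.assoc)
      then have "M * \<bar>2 * (y \<bullet> v) / \<epsilon>\<^sup>2\<bar> \<le> M * (2 * norm v / \<epsilon>)"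
        using M(1) by (intro mult_left_mono) auto
      then have "\<bar>?\<phi>' (?s y) (2 * (y \<bullet> v) / \<epsilon>\<^sup>2)\<bar> \<le> M * (2 * norm v / \<epsilon>)"
        using M'[OF ss] order_trans by blast
      moreover have "norm (B y - ?B' 0 y) \<le> \<eta> * \<epsilon>"
        using d0[OF True] True \<eta>(1) by (meson mult_left_mono less_imp_le order_trans)
      ultimately have "norm (?\<phi>' (?s y) (2 * (y \<bullet> v) / \<epsilon>\<^sup>2) *\<^sub>R (B y - ?B' 0 y))
          \<le> (M * (2 * norm v / \<epsilon>)) * (\<eta> * \<epsilon>)"
        unfolding norm_scaleR using M(1) \<epsilon>(1) by (intro mult_mono) auto
      then show ?thesis using \<epsilon>(1) by (simp add: mult_ac)
    qed
    finally show ?thesis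
      unfolding \<eta>(2)[symmetric] by (simp add: algebra_simps)
  next
    case False
    have op: "open (- cball (0::'a) \<epsilon>)" by auto
    have "(H has_derivative (\<lambda>v. 0)) (at y)"
      by (rule has_derivative_transform_within_open[OF has_derivative_const[of 0] op])
        (use False in \<open>auto simp: H0\<close>)
    from frechet_derivative_at[OF this, symmetric] show ?thesis
      using \<delta> by simp
  qed
  show thesis
  proof (rule that[OF \<epsilon> CH _ DH])
    fix y :: 'a
    assume y: "norm y < \<epsilon> / 2"
    have "y \<bullet> y \<le> (\<epsilon> / 2)\<^sup>2"
      unfolding dot_square_norm using y by (intro power_mono) auto
    then have "?s y \<le> 1/4"
      using \<epsilon>(1) by (simp add: divide_simps power2_eq_square)
    then show "H y = B y - ?B' 0 y"
      by (simp add: H_def \<phi>(2))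
  qed (use H0 \<epsilon> in \<open>auto simp: H_def\<close>)
qed

section \<open>Global fibrations from perturbed linear ones\<close>

text \<open>The expression is homogeneous of degree one in (a, t) and in v separately, so the
  minimum of its norm over a product of two unit spheres serves as the constant.\<close>

lemma nonsingular_lower_bound:
  fixes \<beta> :: "real^'n \<Rightarrow> real^'n^'n"
  assumes \<beta>: "linear \<beta>" and U: "subspace U" and V: "subspace V"
    and ns: "\<And>a t v. t \<in> U \<Longrightarrow> v \<in> V \<Longrightarrow> v \<noteq> 0 \<Longrightarrow> (a, t) \<noteq> 0 \<Longrightarrow> a *\<^sub>R v + \<beta> v *v t \<noteq> 0"
  obtains c where "c > 0"
    "\<And>a t v. t \<in> U \<Longrightarrow> v \<in> V \<Longrightarrow> c * norm (a::real, t) * norm v \<le> norm (a *\<^sub>R v + \<beta> v *v t)"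
proof -
  let ?f = "\<lambda>(w :: real \<times> (real^'n), v). fst w *\<^sub>R v + \<beta> v *v snd w"
  define K where "K = (sphere (0 :: real \<times> (real^'n)) 1 \<inter> (UNIV \<times> U)) \<times> (sphere 0 1 \<inter> V)"
  have "compact K"
    unfolding K_def by (intro compact_Times compact_Int_closed closed_Times closed_subspace U V compact_sphere closed_UNIV)
  have cont: "continuous_on K (\<lambda>x. norm (?f x))"
    unfolding case_prod_unfold
    by (intro continuous_on_norm continuous_on_add continuous_on_scaleR continuous_on_fst
        continuous_on_snd continuous_on_id
        bounded_bilinear.continuous_on[OF bounded_bilinear_matrix_vector_mult]
        linear_continuous_on_compose[OF _ \<beta>])
  \<comment> \<open>The product of spheres is empty exactly when \<open>V\<close> is zero, that is,
    when the plane is the whole space.\<close>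
  have "\<exists>c>0. \<forall>x\<in>K. c \<le> norm (?f x)"
  proof (cases "K = {}")
    case True
    then show ?thesis by (auto intro: exI[of _ 1])
  next
    case False
    obtain x where x: "x \<in> K" "\<And>y. y \<in> K \<Longrightarrow> norm (?f x) \<le> norm (?f y)"
      using continuous_attains_inf[OF \<open>compact K\<close> False cont] by blast
    obtain a t v where "x = ((a, t), v)" by (metis surj_pair)
    then have "?f x \<noteq> 0"
      using x(1) ns[of t v a] unfolding K_def by force
    with x(2) show ?thesis by (intro exI[of _ "norm (?f x)"]) auto
  qed
  then obtain c where c: "c > 0" "\<And>x. x \<in> K \<Longrightarrow> c \<le> norm (?f x)" by blast
  have "c * norm (a, t) * norm v \<le> norm (a *\<^sub>R v + \<beta> v *v t)"
    if t: "t \<in> U" and v: "v \<in> V" for a t v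
  proof (cases "(a, t) = 0 \<or> v = 0")
    case False
    define m k where "m = inverse (norm (a, t))" and "k = inverse (norm v)"
    have mk: "m > 0" "k > 0" "m * norm (a, t) = 1" "k * norm v = 1"
      using False by (auto simp: m_def k_def)
    have "norm (m *\<^sub>R (a, t)) = 1" "norm (k *\<^sub>R v) = 1"
      unfolding norm_scaleR using mk by auto
    then have "((m * a, m *\<^sub>R t), k *\<^sub>R v) \<in> K"
      using t v U V unfolding K_def by (auto intro: subspace_scale)
    from c(2)[OF this] have "c \<le> norm ((m * k) *\<^sub>R (a *\<^sub>R v + \<beta> v *v t))"
      by (simp add: linear_scale[OF \<beta>] scaleR_matrix_vector_assoc[symmetric]
          matrix_vector_mult_scaleR scaleR_right_distrib mult_ac)
    also have "\<dots> = m * k * norm (a *\<^sub>R v + \<beta> v *v t)"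
      using mk by simp
    finally have "c * norm (a, t) * norm v \<le> m * k * norm (a *\<^sub>R v + \<beta> v *v t) * norm (a, t) * norm v"
      by (intro mult_right_mono) auto
    also have "\<dots> = (m * norm (a, t)) * (k * norm v) * norm (a *\<^sub>R v + \<beta> v *v t)"
      by (simp only: mult_ac)
    finally show ?thesis by (simp add: mk)
  qed auto
  with c(1) show thesis using that by blast
qed

text \<open>Pairing with a vector orthogonal to \<open>S\<close> gives a function that vanishes on
  \<open>T\<close>, hence has derivative zero; \<open>S\<close> is its own double orthogonal
  complement.\<close>

lemma has_derivative_in_subspace:
  fixes f :: "'a::real_normed_vector \<Rightarrow> 'b::euclidean_space"
  assumes f: "(f has_derivative f') (at x)" and T: "open T" "x \<in> T"
    and S: "subspace S" "\<And>y. y \<in> T \<Longrightarrow> f y \<in> S"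
  shows "f' v \<in> S"
proof -
  have "w \<bullet> f' v = 0" if w: "w \<in> orthogonal_comp S" for w
  proof -
    have "((\<lambda>y. w \<bullet> f y) has_derivative (\<lambda>v. w \<bullet> f' v)) (at x)"
      by (intro has_derivative_inner_right f)
    then have "((\<lambda>y. 0) has_derivative (\<lambda>v. w \<bullet> f' v)) (at x)"
      by (rule has_derivative_transform_within_open[OF _ T])
        (use w S(2) in \<open>auto simp: orthogonal_comp_def orthogonal_def inner_commute\<close>)
    then have "(\<lambda>v. w \<bullet> f' v) = (\<lambda>v. 0)"
      using has_derivative_unique has_derivative_const by blast
    then show ?thesis by metis
  qed
  then have "f' v \<in> orthogonal_comp (orthogonal_comp S)"
    by (simp add: orthogonal_comp_def orthogonal_def)
  then show ?thesis
    using orthogonal_comp_self[OF S(1)] by simp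
qed

text \<open>\<open>P\<close> is the orthogonal projection onto the span of \<open>u\<close>, and
  \<open>\<beta> + H\<close> is the slope of the plane as a function of its base point. Giving
  \<open>H\<close> the share c/2 leaves c/2 for the lower bounds and yields contraction factor 1/2
  in the fixed point argument.\<close>

locale perturbed_linear_fibration =
  fixes u :: "(real^'k^'n) set" and P :: "real^'n^'n"
    and \<beta> H :: "real^'n \<Rightarrow> real^'n^'n" and x0 :: "real^'n" and c :: real
  assumes u: "u \<in> OGr"
    and P_mem: "\<And>z. P *v z \<in> ospan u" and P_perp: "\<And>z. z - P *v z \<in> orthogonal_comp (ospan u)"
    and linear_\<beta>: "linear \<beta>" and \<beta>_mem: "\<And>y. \<beta> y \<in> Hom_perp u"
    and H_mem: "\<And>y. H y \<in> Hom_perp u" and Ck_H: "\<And>m. Ck_on m UNIV H"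
    and c_pos: "c > 0"
    and \<beta>_bound: "\<And>a t v. t \<in> ospan u \<Longrightarrow> v \<in> orthogonal_comp (ospan u) \<Longrightarrow>
      c * norm (a::real, t) * norm v \<le> norm (a *\<^sub>R v + \<beta> v *v t)"
    and H_bound: "\<And>y v t. norm (frechet_derivative H (at y) v *v t) \<le> c / 2 * norm v * norm t"
begin

abbreviation U where "U \<equiv> ospan u"
abbreviation V where "V \<equiv> orthogonal_comp (ospan u)"
abbreviation H' where "H' y \<equiv> frechet_derivative H (at y)"

definition q where "q z = z - P *v z"
definition C where "C z = \<beta> (q z) + H (q z)"
definition C' where "C' z v = \<beta> (q v) + H' (q z) (q v)"
text \<open>Writing z = t + y with t in \<open>U\<close> and y in \<open>V\<close>, this is the
  point with parameter t on the plane through x0 + y, since \<open>C z\<close> kills y. Using one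
  variable z avoids coordinates on the two factors and makes \<Phi> an endomap of the ambient space.
  As \<open>C\<close> depends on z only through \<open>q\<close>, the translates of \<open>U\<close>
  are sent to the prospective fibers.\<close>

definition \<Phi> where "\<Phi> z = x0 + z + C z *v z"

lemma subspace_U: "subspace U"
  using subspace_ospan[OF u] .

lemma U_V_0: "z \<in> U \<Longrightarrow> z \<in> V \<Longrightarrow> z = 0"
  by (rule orthogonal_comp_Int_eq_0)

lemma q_mem: "q z \<in> V"
  using P_perp by (simp add: q_def)

lemma P_U: "z \<in> U \<Longrightarrow> P *v z = z"
  using U_V_0[of "z - P *v z"] P_mem P_perp subspace_diff[OF subspace_U] by auto

lemma P_V: "z \<in> V \<Longrightarrow> P *v z = 0"
  using U_V_0[of "P *v z"] P_mem P_perp[of z] subspace_diff[OF subspace_orthogonal_comp, of z U "z - P *v z"]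
  by auto

lemma q_V: "z \<in> V \<Longrightarrow> q z = z"
  by (simp add: q_def P_V)

lemma linear_q: "linear q"
  unfolding q_def by (intro linear_compose_sub linear_id[unfolded id_def] matrix_vector_mul_linear)

lemma q_add_U: "t \<in> U \<Longrightarrow> q (z + t) = q z"
  by (simp add: q_def matrix_vector_right_distrib P_U)

lemma decompose: "z = P *v z + q z"
  by (simp add: q_def)

lemma DH: "(H has_derivative H' y) (at y)"
  using Ck_on_SucD(1)[OF open_UNIV Ck_H] by simp

lemma H'_mem: "H' y v \<in> Hom_perp u"
  by (rule has_derivative_in_subspace[OF DH open_UNIV _ subspace_Hom_perp]) (auto simp: H_mem)

lemma C_mem: "C z \<in> Hom_perp u"
  unfolding C_def by (intro subspace_add[OF subspace_Hom_perp] \<beta>_mem H_mem)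

lemma C_add_U: "t \<in> U \<Longrightarrow> C (z + t) = C z"
  by (simp add: C_def q_add_U)

lemma C'_mem: "C' z v \<in> Hom_perp u"
  unfolding C'_def by (intro subspace_add[OF subspace_Hom_perp] \<beta>_mem H'_mem)

lemma Hom_V: "L \<in> Hom_perp u \<Longrightarrow> w \<in> V \<Longrightarrow> L *v w = 0"
  unfolding Hom_perp_def by blast

lemma Hom_P: "L \<in> Hom_perp u \<Longrightarrow> L *v z = L *v (P *v z)"
  by (subst decompose[of z]) (simp add: matrix_vector_right_distrib Hom_V q_mem)

lemma Ck_C: "Ck_on m UNIV C"
proof -
  have q: "Ck_on m UNIV q"
    using linear_q by (intro Ck_on_bounded_linear) (auto simp: linear_conv_bounded_linear)
  show ?thesis
    unfolding C_def
    by (intro Ck_on_add Ck_on_linear_compose[OF open_UNIV _ q] Ck_on_compose[OF _ _ _ q Ck_H])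
      (use linear_\<beta> in \<open>auto simp: linear_conv_bounded_linear\<close>)
qed

lemma DC: "(C has_derivative C' z) (at z)"
proof -
  have "(q has_derivative q) (at z)"
    by (rule linear_imp_has_derivative[OF linear_q])
  then show ?thesis
    unfolding C_def C'_def
    by (intro has_derivative_add has_derivative_compose[OF _ DH]
        has_derivative_compose[OF _ linear_imp_has_derivative[OF linear_\<beta>]])
qed

text \<open>The contribution of \<open>H'\<close> is at most c/2 |q v| |t|, and |t| <= |(a, t)|, so
  at least half of \<open>\<beta>_bound\<close> remains.\<close>

lemma C'_bound:
  assumes "t \<in> U"
  shows "c / 2 * norm (a::real, t) * norm (q v) \<le> norm (a *\<^sub>R q v + C' z v *v t)"
proof -
  have "c / 2 * norm (q v) * norm t \<le> c / 2 * norm (q v) * norm (a, t)"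
    using c_pos by (intro mult_left_mono norm_snd_le) auto
  then have "norm (H' (q z) (q v) *v t) \<le> c / 2 * norm (a, t) * norm (q v)"
    using H_bound[of "q z" "q v" t] by (simp add: mult_ac)
  moreover have "norm (a *\<^sub>R q v + \<beta> (q v) *v t) \<le>
      norm (a *\<^sub>R q v + C' z v *v t) + norm (H' (q z) (q v) *v t)"
    using norm_triangle_ineq4[of "a *\<^sub>R q v + C' z v *v t" "H' (q z) (q v) *v t"]
    by (simp add: C'_def matrix_vector_mult_add_rdistrib)
  ultimately show ?thesis
    using \<beta>_bound[OF assms q_mem, of a v] by (simp add: algebra_simps)
qed

text \<open>The mean value inequality on the whole space, for fixed t, turns the derivative bound
  into one for differences, as injectivity and the contraction require.\<close>

lemma H_lipschitz: "norm ((H y - H y') *v t) \<le> c / 2 * norm (y - y') * norm t"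
proof -
  have "norm (H y *v t - H y' *v t) \<le> (c / 2 * norm t) * norm (y - y')"
  proof (rule differentiable_bound[of UNIV _ "\<lambda>y v. H' y v *v t"])
    show "((\<lambda>y. H y *v t) has_derivative (\<lambda>v. H' x v *v t)) (at x within UNIV)" for x
      using bounded_linear.has_derivative[OF
          bounded_bilinear.bounded_linear_left[OF bounded_bilinear_matrix_vector_mult] DH] by simp
    show "onorm (\<lambda>v. H' x v *v t) \<le> c / 2 * norm t" for x
      using H_bound[of x _ t] c_pos by (intro onorm_bound) (auto simp: mult_ac)
  qed auto
  then show ?thesis
    by (simp add: matrix_vector_mult_diff_rdistrib mult_ac)
qed

lemma D\<Phi>: "(\<Phi> has_derivative (\<lambda>v. v + (C z *v v + C' z v *v z))) (at z)"
proof -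
  have "(\<Phi> has_derivative (\<lambda>v. (0 + v) + (C z *v v + C' z v *v z))) (at z)"
    unfolding \<Phi>_def
    by (intro has_derivative_add has_derivative_const has_derivative_ident
        bounded_bilinear.FDERIV[OF bounded_bilinear_matrix_vector_mult] DC)
  then show ?thesis by simp
qed

text \<open>All slopes take values in \<open>V\<close>, so \<Phi> preserves the component in
  \<open>U\<close> relative to x0. Inverting \<Phi> is thereby a separate problem in
  \<open>V\<close> for each t.\<close>

lemma P_\<Phi>: "P *v (\<Phi> z - x0) = P *v z"
  by (simp add: \<Phi>_def matrix_vector_right_distrib P_V[OF Hom_perp_mem[OF u C_mem]])

text \<open>A kernel vector equals minus an element of \<open>V\<close>, so it lies in
  \<open>V\<close> and the term \<open>C z *v v\<close> drops out. What remains is excluded by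
  \<open>C'_bound\<close> with a = 1 and t = \<open>P *v z\<close>.\<close>

lemma D\<Phi>_inj:
  assumes "v + (C z *v v + C' z v *v z) = 0"
  shows "v = 0"
proof -
  have mem: "C z *v v + C' z v *v z \<in> V"
    by (intro subspace_add[OF subspace_orthogonal_comp] Hom_perp_mem[OF u] C_mem C'_mem)
  have "v = - (C z *v v + C' z v *v z)"
    using assms by (simp only: eq_neg_iff_add_eq_0)
  then have v: "v \<in> V"
    using mem by (metis subspace_neg subspace_orthogonal_comp)
  then have "1 *\<^sub>R q v + C' z v *v (P *v z) = 0"
    using assms by (simp add: q_V Hom_V[OF C_mem] Hom_P[OF C'_mem, of z v z, symmetric])
  then have "c / 2 * norm (1::real, P *v z) * norm (q v) \<le> 0"
    using C'_bound[OF P_mem[of z], of 1 v z] by simp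
  moreover have "norm (1::real, P *v z) > 0" by (simp add: zero_prod_def)
  ultimately show ?thesis
    using c_pos v by (simp add: mult_le_0_iff q_V)
qed

lemma \<Phi>_eq: "\<Phi> z = x0 + P *v z + (q z + C z *v (P *v z))"
  unfolding \<Phi>_def using Hom_P[OF C_mem, of z z] decompose[of z] by (simp add: algebra_simps)

text \<open>The finite-difference version of the preceding argument: the two points share t, and the
  lower bound for \<beta> with a = 1 exceeds the Lipschitz bound for \<open>H\<close> unless the
  components in \<open>V\<close> agree.\<close>

lemma inj_\<Phi>: "inj \<Phi>"
proof (rule injI)
  fix z z' assume eq: "\<Phi> z = \<Phi> z'"
  let ?t = "P *v z"
  have t: "P *v z' = ?t"
    using P_\<Phi>[of z] P_\<Phi>[of z'] eq by simp
  have d: "q z - q z' \<in> V"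
    by (intro subspace_diff[OF subspace_orthogonal_comp] q_mem)
  have "1 *\<^sub>R (q z - q z') + \<beta> (q z - q z') *v ?t = - ((H (q z) - H (q z')) *v ?t)"
    using eq unfolding \<Phi>_eq t C_def linear_diff[OF linear_\<beta>]
    by (simp add: matrix_vector_mult_add_rdistrib matrix_vector_mult_diff_rdistrib algebra_simps)
  then have "c * norm (1::real, ?t) * norm (q z - q z') \<le> c / 2 * norm (q z - q z') * norm ?t"
    using \<beta>_bound[OF P_mem d, of 1 z] H_lipschitz[of "q z" "q z'" ?t] by simp
  also have "\<dots> \<le> c / 2 * norm (q z - q z') * norm (1::real, ?t)"
    using c_pos by (intro mult_left_mono norm_snd_le) auto
  finally have "c / 2 * (norm (1::real, ?t) * norm (q z - q z')) \<le> 0"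
    by (simp add: mult_ac)
  moreover have "norm (1::real, ?t) > 0" by (simp add: zero_prod_def)
  ultimately have "q z = q z'"
    using c_pos by (simp add: mult_le_0_iff)
  then show "z = z'"
    using decompose[of z] decompose[of z'] t by simp
qed

lemma surj_\<Phi>: "surj \<Phi>"
proof -
  have "\<exists>z. \<Phi> z = x" for x
  proof -
    define t w where "t = P *v (x - x0)" and "w = q (x - x0)"
    have t: "t \<in> U" and w: "w \<in> V"
      unfolding t_def w_def by (rule P_mem, rule q_mem)
    have x: "x = x0 + t + w"
      by (simp add: t_def w_def q_def)
    \<comment> \<open>\<open>L\<close> acts on the whole space instead of \<open>V\<close>, so that
      injectivity yields surjectivity directly. It differs from the identity by vectors of
      \<open>V\<close>, hence \<open>L z\<close> in \<open>V\<close> forces z in \<open>V\<close>,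
      where the lower bound with a = 1 applies.\<close>
    define L where "L z = z + \<beta> (q z) *v t" for z
    have nt: "norm (1::real, t) > 0" "norm t \<le> norm (1::real, t)"
      by (simp_all add: zero_prod_def norm_snd_le)
    have linear_L: "linear L"
    proof -
      have "linear (\<lambda>z. \<beta> (q z) *v t)"
        by (rule linearI)
          (simp_all add: linear_add[OF linear_q] linear_scale[OF linear_q] linear_add[OF linear_\<beta>]
            linear_scale[OF linear_\<beta>] matrix_vector_mult_add_rdistrib scaleR_matrix_vector_assoc)
      then show ?thesis
        unfolding L_def by (intro linear_compose_add linear_id[unfolded id_def])
    qed
    have L_V: "z \<in> V" if "L z \<in> V" for z
      using subspace_diff[OF subspace_orthogonal_comp that Hom_perp_mem[OF u \<beta>_mem[of "q z"], of t]]
      by (simp add: L_def)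
    have L_bound: "c * norm (1::real, t) * norm z \<le> norm (L z)" if "L z \<in> V" for z
      using \<beta>_bound[OF t L_V[OF that], of 1] q_V[OF L_V[OF that]] by (simp add: L_def)
    have "inj L"
      unfolding linear_injective_0[OF linear_L]
    proof (intro allI impI)
      fix z assume "L z = 0"
      then have "c * norm (1::real, t) * norm z \<le> 0"
        using L_bound[of z] subspace_0[OF subspace_orthogonal_comp] by auto
      then show "z = 0"
        using c_pos nt(1) by (simp add: mult_le_0_iff)
    qed
    then have "surj L"
      using linear_injective_imp_surjective[OF linear_L] by blast
    then obtain S where S: "\<And>y. L (S y) = y"
      by (metis surjD)
    \<comment> \<open>A fixed point of \<open>F\<close> solves y + \<beta>(y) t + H(y) t = w. On
      differences lying in \<open>V\<close>, the inverse of \<open>L\<close> contributes 1 / (c |(1,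
      t)|) and \<open>H\<close> contributes c |t| / 2, so the contraction factor is at most 1/2
      whatever t is.\<close>
    define F where "F y = S (w - H y *v t)" for y
    have F_mem: "w - H y *v t \<in> V" for y
      by (intro subspace_diff[OF subspace_orthogonal_comp] w Hom_perp_mem[OF u H_mem])
    have "dist (F y) (F y') \<le> 1/2 * dist y y'" for y y'
    proof -
      have L: "L (F y - F y') = - ((H y - H y') *v t)"
        by (simp add: linear_diff[OF linear_L] F_def S matrix_vector_mult_diff_rdistrib)
      have "L (F y - F y') \<in> V"
        using subspace_diff[OF subspace_orthogonal_comp F_mem F_mem, of y y']
        by (simp add: linear_diff[OF linear_L] F_def S)
      from L_bound[OF this]
      have "c * norm (1::real, t) * norm (F y - F y') \<le> c / 2 * norm (y - y') * norm t"
        using H_lipschitz[of y y' t] by (simp add: L)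
      also have "\<dots> \<le> c / 2 * norm (y - y') * norm (1::real, t)"
        using c_pos nt by (intro mult_left_mono) auto
      also have "\<dots> = c * norm (1::real, t) * (1/2 * norm (y - y'))"
        by simp
      finally show ?thesis
        using c_pos nt(1) by (simp add: dist_norm mult_le_cancel_left_pos)
    qed
    then obtain y where y: "F y = y"
      using banach_fix_type[of "1/2" F] by auto
    then have L_y: "L y = w - H y *v t"
      by (metis F_def S)
    then have "y \<in> V"
      using L_V F_mem by simp
    have "P *v (t + y) = t"
      using P_V[OF \<open>y \<in> V\<close>] P_U[OF t] by (simp add: matrix_vector_right_distrib)
    moreover have "q (t + y) = y"
      using q_add_U[OF t, of y] q_V[OF \<open>y \<in> V\<close>] by (simp add: add.commute)
    ultimately have "\<Phi> (t + y) = x"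
      using L_y q_V[OF \<open>y \<in> V\<close>]
      by (simp add: \<Phi>_eq C_def L_def x matrix_vector_mult_add_rdistrib algebra_simps)
    then show ?thesis by blast
  qed
  then show ?thesis by (metis surjI)
qed

section \<open>The global fibration and its nondegeneracy\<close>

definition \<Psi> where "\<Psi> = inv \<Phi>"

lemma \<Psi>_\<Phi>: "\<Psi> (\<Phi> z) = z"
  unfolding \<Psi>_def by (rule inv_f_f[OF inj_\<Phi>])

lemma \<Phi>_\<Psi>: "\<Phi> (\<Psi> x) = x"
  unfolding \<Psi>_def by (rule surj_f_inv_f[OF surj_\<Phi>])

lemma Ck_\<Psi>: "Ck_on m UNIV \<Psi>"
proof (rule Ck_on_inverse_function[OF _ _ \<Psi>_\<Phi> \<Phi>_\<Psi>])
  show "Ck_on m UNIV \<Phi>" for m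
    unfolding \<Phi>_def by (intro Ck_on_add Ck_on_const Ck_on_id Ck_on_matrix_vector_mult Ck_C open_UNIV)
  show "v = 0" if "frechet_derivative \<Phi> (at z) v = 0" for z v
    using that unfolding frechet_derivative_at[OF D\<Phi>, symmetric] by (rule D\<Phi>_inj)
qed

definition direction where "direction x = chart u (C (\<Psi> x))"

text \<open>\<Psi> straightens the fibers: \<open>C\<close> is constant along \<open>U\<close>, so
  \<Phi> is affine on each translate of \<open>U\<close>. Constancy of the direction along a fiber
  is a consequence.\<close>

lemma \<Psi>_add:
  assumes "v \<in> ospan (direction x)"
  obtains t where "t \<in> U" "\<Psi> (x + v) = \<Psi> x + t"
proof -
  obtain t where t: "t \<in> U" "v = t + C (\<Psi> x) *v t"
    using assms unfolding direction_def ospan_chart by blast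
  have "\<Phi> (\<Psi> x + t) = \<Phi> (\<Psi> x) + v"
    using t by (simp add: \<Phi>_def C_add_U matrix_vector_right_distrib)
  then have "\<Psi> (x + v) = \<Psi> x + t"
    by (metis \<Phi>_\<Psi> \<Psi>_\<Phi>)
  with t(1) show thesis using that by blast
qed

lemma plane_fibration_direction: "plane_fibration UNIV direction"
  unfolding plane_fibration_def
proof (intro conjI ballI)
  fix x v assume "v \<in> ospan (direction x)"
  then obtain t where "t \<in> U" "\<Psi> (x + v) = \<Psi> x + t"
    using \<Psi>_add by blast
  then show "direction (x + v) = direction x"
    by (simp add: direction_def C_add_U)
qed (auto simp: direction_def intro: chart_in_OGr u C_mem)

theorem smooth_nondeg_fibration_direction: "smooth_nondeg_fibration UNIV direction"
proof -
  obtain M where M: "u = oriented_plane_of M" "inj (\<lambda>t. M *v t)"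
    using OGrE[OF u] .
  define X where "X x = (mat 1 + C (\<Psi> x)) ** M" for x
  have dir: "direction = (\<lambda>x. oriented_plane_of (X x))"
    using M(1) chart_oriented_plane_of[of M] unfolding direction_def X_def by metis
  have range_X: "range (\<lambda>t. X x *v t) = (\<lambda>t. t + C (\<Psi> x) *v t) ` U" for x
    using ospan_chart[of u "C (\<Psi> x)"] dir
    unfolding direction_def[symmetric] by (simp add: ospan_oriented_plane_of)
  have Xs: "X x *v s = M *v s + C (\<Psi> x) *v (M *v s)" for x s
    by (simp add: X_def matrix_vector_mul_assoc[symmetric] matrix_vector_mult_add_rdistrib)
  have MU: "M *v s \<in> U" for s
    by (simp add: M(1) ospan_oriented_plane_of)
  have M0: "M *v s = 0 \<Longrightarrow> s = 0" for s
    using M(2) by (metis (mono_tags) injD matrix_vector_mult_0_right)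
  have CX: "Ck_on m UNIV X" for m
    unfolding X_def
    by (intro Ck_on_matrix_mult Ck_on_add Ck_on_const Ck_on_compose[OF _ _ _ Ck_\<Psi> Ck_C]) auto
  have inj_X: "inj (\<lambda>s. X x *v s)" for x
    unfolding linear_injective_0[OF matrix_vector_mul_linear]
  proof (intro allI impI)
    fix s assume "X x *v s = 0"
    then have "M *v s = - (C (\<Psi> x) *v (M *v s))"
      unfolding Xs by (simp add: eq_neg_iff_add_eq_0)
    then have "M *v s \<in> V"
      using Hom_perp_mem[OF u C_mem] by (metis subspace_neg subspace_orthogonal_comp)
    then show "s = 0" using U_V_0 MU M0 by blast
  qed
  have D\<Psi>: "(\<Psi> has_derivative frechet_derivative \<Psi> (at x)) (at x)" for x
    using Ck_on_SucD(1)[OF open_UNIV Ck_\<Psi>] by simp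
  \<comment> \<open>If the derivative stayed in the plane, its component t' in \<open>U\<close>
    would vanish because \<open>C'\<close> has values in \<open>V\<close>; then
    \<open>C'_bound\<close> with a = 0 puts the preimage of \<xi> under the derivative of \<Phi>
    into \<open>U\<close>. That derivative maps \<open>U\<close> onto the plane itself, so \<xi>
    would be both tangent and orthogonal to it.\<close>
  have nd: "frechet_derivative X (at x) \<xi> *v s \<notin> range (\<lambda>t. X x *v t)"
    if \<xi>: "\<xi> \<in> orthogonal_comp (range (\<lambda>t. X x *v t))" "\<xi> \<noteq> 0" and "s \<noteq> 0" for x \<xi> s
  proof
    assume mem: "frechet_derivative X (at x) \<xi> *v s \<in> range (\<lambda>t. X x *v t)"
    let ?z = "\<Psi> x" and ?\<zeta> = "frechet_derivative \<Psi> (at x) \<xi>" and ?t = "M *v s"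
    have "(X has_derivative (\<lambda>v. (mat 1 + C ?z) ** 0 +
        (0 + C' ?z (frechet_derivative \<Psi> (at x) v)) ** M)) (at x)"
      unfolding X_def
      by (intro bounded_bilinear.FDERIV[OF bounded_bilinear_matrix_matrix_mult] has_derivative_add
          has_derivative_const has_derivative_compose[OF D\<Psi> DC])
    from fun_cong[OF frechet_derivative_at[OF this], of \<xi>]
    have "frechet_derivative X (at x) \<xi> = C' ?z ?\<zeta> ** M"
      by (simp add: bounded_bilinear.zero_right[OF bounded_bilinear_matrix_matrix_mult])
    then obtain t' where t': "t' \<in> U" "C' ?z ?\<zeta> *v ?t = t' + C ?z *v t'"
      using mem unfolding range_X by (auto simp: matrix_vector_mul_assoc)
    have "t' = C' ?z ?\<zeta> *v ?t - C ?z *v t'"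
      using t'(2) by simp
    then have "t' \<in> V"
      using subspace_diff[OF subspace_orthogonal_comp Hom_perp_mem[OF u C'_mem] Hom_perp_mem[OF u C_mem]]
      by metis
    then have "C' ?z ?\<zeta> *v ?t = 0"
      using U_V_0[OF t'(1)] t'(2) by simp
    then have "c / 2 * norm (0::real, ?t) * norm (q ?\<zeta>) \<le> 0"
      using C'_bound[OF MU, of 0 s ?\<zeta> ?z] by simp
    moreover have "norm (0::real, ?t) > 0"
      using M0 \<open>s \<noteq> 0\<close> by (auto simp: zero_prod_def)
    ultimately have q0: "q ?\<zeta> = 0"
      using c_pos by (simp add: mult_le_0_iff)
    then have "?\<zeta> \<in> U"
      using decompose[of ?\<zeta>] P_mem by (metis add.right_neutral)
    have "C' ?z ?\<zeta> = 0"
      unfolding C'_def q0 using linear_0[OF linear_\<beta>] linear_0[OF has_derivative_linear[OF DH]] by simp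
    moreover have "?\<zeta> + (C ?z *v ?\<zeta> + C' ?z ?\<zeta> *v ?z) = \<xi>"
    proof -
      have "((\<lambda>x. \<Phi> (\<Psi> x)) has_derivative (\<lambda>v. frechet_derivative \<Psi> (at x) v +
          (C ?z *v frechet_derivative \<Psi> (at x) v + C' ?z (frechet_derivative \<Psi> (at x) v) *v ?z))) (at x)"
        by (rule has_derivative_compose[OF D\<Psi> D\<Phi>])
      from has_derivative_unique[OF this[unfolded \<Phi>_\<Psi>] has_derivative_ident, THEN fun_cong]
      show ?thesis .
    qed
    ultimately have "\<xi> = ?\<zeta> + C ?z *v ?\<zeta>" by simp
    then have "\<xi> \<in> range (\<lambda>t. X x *v t)"
      unfolding range_X using \<open>?\<zeta> \<in> U\<close> by blast
    then show False
      using orthogonal_comp_Int_eq_0[OF _ \<xi>(1)] \<xi>(2) by simp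
  qed
  have "smooth_plane_map UNIV direction" "nondegenerate UNIV direction"
    unfolding dir
    by (rule smooth_nondegenerate_frame[of X]; (rule CX | rule inj_X | (rule nd; assumption)))+
  then show ?thesis
    unfolding smooth_nondeg_fibration_def using plane_fibration_direction by blast
qed

end

section \<open>Extension of germs\<close>

lemma plane_fibrationD:
  assumes "plane_fibration T \<pi>" "x \<in> T" "v \<in> ospan (\<pi> x)"
  shows "x + v \<in> T" "\<pi> (x + v) = \<pi> x"
  using assms unfolding plane_fibration_def by auto

lemma smooth_plane_mapE:
  assumes "smooth_plane_map T \<pi>" "x \<in> T"
  obtains S where "open S" "x \<in> S" "S \<subseteq> T" "\<And>y. y \<in> S \<Longrightarrow> \<pi> y \<in> chart (\<pi> x) ` Hom_perp (\<pi> x)"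
    "smooth_on S (\<lambda>y. chart_inv (\<pi> x) (\<pi> y))"
  using assms(1)[unfolded smooth_plane_map_def, rule_format, OF assms(2)] that by metis

text \<open>Differentiating the constancy of the direction along the fibers at a point where the
  fibers would focus shows that they do not.\<close>

lemma fibers_do_not_focus:
  fixes T :: "(real^'n) set" and \<pi> :: "real^'n \<Rightarrow> (real^'k^'n) set" and x0 :: "real^'n"
  defines "u \<equiv> \<pi> x0"
  assumes fib: "plane_fibration T \<pi>" and sm: "smooth_plane_map T \<pi>" and x0: "x0 \<in> T"
    and r: "r > 0" "ball x0 r \<subseteq> T"
    and B: "\<And>y. norm y < r \<Longrightarrow> B y \<in> Hom_perp u" "\<And>y. norm y < r \<Longrightarrow> chart u (B y) = \<pi> (x0 + y)"
    and DB: "(B has_derivative \<beta>) (at 0)"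
    and t: "t \<in> ospan u" and eq: "v + \<beta> v *v t = 0"
  shows "v = 0"
proof -
  have u: "u \<in> OGr" using fib x0 unfolding plane_fibration_def u_def by blast
  have B0: "B 0 = 0"
    using chart_eq_self[OF u B(1)[of 0]] B(2)[of 0] r(1) by (simp add: u_def)
  let ?f = "\<lambda>y. chart_inv u (\<pi> y)"
  \<comment> \<open>The direction at x0 + t is again \<open>u\<close>, so smoothness of \<pi> at
    this possibly distant point is expressed in the same chart as near x0.\<close>
  have x1: "x0 + t \<in> T" "\<pi> (x0 + t) = u"
    using plane_fibrationD[OF fib x0] t by (auto simp: u_def)
  obtain S where S: "open S" "x0 + t \<in> S" "smooth_on S ?f"
    using smooth_plane_mapE[OF sm x1(1)] unfolding x1(2) by metis
  \<comment> \<open>This follows the point with parameter t on the fiber through x0 + s v. Its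
    velocity at s = 0 is v + \<beta>(v) t = 0, while the chart coordinate of the direction along it
    is B (s v), with derivative \<beta>(v).\<close>
  define \<gamma> where "\<gamma> s = x0 + t + s *\<^sub>R v + B (s *\<^sub>R v) *v t" for s :: real
  have "((\<lambda>s. s *\<^sub>R v) has_derivative (\<lambda>s. s *\<^sub>R v)) (at (0::real))"
    by (intro has_derivative_scaleR_left has_derivative_ident)
  then have Bs: "((\<lambda>s. B (s *\<^sub>R v)) has_derivative (\<lambda>s. \<beta> (s *\<^sub>R v))) (at 0)"
    by (rule has_derivative_compose) (simp add: DB)
  have "(\<gamma> has_derivative (\<lambda>s. 0 + s *\<^sub>R v + \<beta> (s *\<^sub>R v) *v t)) (at 0)"
    unfolding \<gamma>_def
    by (intro has_derivative_add has_derivative_const has_derivative_scaleR_left has_derivative_ident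
        bounded_linear.has_derivative[OF bounded_bilinear.bounded_linear_left[OF
          bounded_bilinear_matrix_vector_mult] Bs])
  moreover have "0 + s *\<^sub>R v + \<beta> (s *\<^sub>R v) *v t = 0" for s
  proof -
    have "0 + s *\<^sub>R v + \<beta> (s *\<^sub>R v) *v t = s *\<^sub>R (v + \<beta> v *v t)"
      by (simp add: linear_scale[OF has_derivative_linear[OF DB]] scaleR_matrix_vector_assoc
          scaleR_right_distrib)
    then show ?thesis by (simp add: eq)
  qed
  ultimately have D\<gamma>: "(\<gamma> has_derivative (\<lambda>s. 0)) (at 0)" by simp
  have \<gamma>0: "\<gamma> 0 = x0 + t" by (simp add: \<gamma>_def B0)
  have Df: "(?f has_derivative frechet_derivative ?f (at (\<gamma> 0))) (at (\<gamma> 0))"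
    using smooth_on_differentiable[OF S(1,3,2)] unfolding \<gamma>0 .
  have "((\<lambda>s. ?f (\<gamma> s)) has_derivative (\<lambda>s. frechet_derivative ?f (at (\<gamma> 0)) 0)) (at 0)"
    by (rule has_derivative_compose[OF D\<gamma> Df])
  then have "((\<lambda>s. ?f (\<gamma> s)) has_derivative (\<lambda>s. 0)) (at 0)"
    using linear_0[OF has_derivative_linear[OF Df]] by simp
  moreover define A where "A = {s::real. norm (s *\<^sub>R v) < r}"
  have A: "open A" "0 \<in> A"
    unfolding A_def using r by (auto intro!: open_Collect_less continuous_intros)
  have "?f (\<gamma> s) = B (s *\<^sub>R v)" if "s \<in> A" for s
  proof -
    have s: "norm (s *\<^sub>R v) < r" using that by (simp add: A_def)
    have y: "x0 + s *\<^sub>R v \<in> T"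
      using s r(2) by (auto simp: dist_norm subset_iff)
    have "t + B (s *\<^sub>R v) *v t \<in> ospan (\<pi> (x0 + s *\<^sub>R v))"
      unfolding B(2)[OF s, symmetric] ospan_chart using t by blast
    from plane_fibrationD(2)[OF fib y this] have "\<pi> (\<gamma> s) = chart u (B (s *\<^sub>R v))"
      unfolding B(2)[OF s] \<gamma>_def by (simp add: algebra_simps)
    then show ?thesis
      by (simp add: chart_inv_chart[OF u B(1)[OF s]])
  qed
  ultimately have "((\<lambda>s. B (s *\<^sub>R v)) has_derivative (\<lambda>s. 0)) (at 0)"
    by (rule has_derivative_transform_within_open[OF _ A])
  from fun_cong[OF has_derivative_unique[OF Bs this], of 1] have "\<beta> v = 0" by simp
  then show ?thesis using eq by simp
qed

theorem theorem1p5: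
  fixes T :: "(real^'n::finite) set" and \<pi> :: "real^'n \<Rightarrow> (real^'k::finite^'n) set"
    and x0 :: "real^'n"
  assumes "smooth_nondeg_fibration T \<pi>" and "x0 \<in> T"
  shows "\<exists>\<pi>' :: real^'n \<Rightarrow> (real^'k^'n) set. smooth_nondeg_fibration UNIV \<pi>' \<and>
           (\<exists>W. open W \<and> fiber \<pi> x0 \<subseteq> W \<and> W \<subseteq> T \<and> (\<forall>y\<in>W. \<pi>' y = \<pi> y))"
proof -
  have fib: "plane_fibration T \<pi>" and sm: "smooth_plane_map T \<pi>" and nd: "nondegenerate T \<pi>"
    using assms(1) unfolding smooth_nondeg_fibration_def by auto
  have opT: "open T" using fib unfolding plane_fibration_def by blast
  define u where "u = \<pi> x0"
  have u: "u \<in> OGr" using fib assms(2) unfolding plane_fibration_def u_def by blast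
  let ?V = "orthogonal_comp (ospan u)"
  let ?f = "\<lambda>y. chart_inv u (\<pi> y)"
  obtain P :: "real^'n^'n" where P: "\<And>z. P *v z \<in> ospan u" "\<And>z. z - P *v z \<in> ?V"
    using orthogonal_projection_matrix[OF subspace_ospan[OF u]] by metis
  obtain S where S: "open S" "x0 \<in> S" "S \<subseteq> T" "\<And>y. y \<in> S \<Longrightarrow> \<pi> y \<in> chart u ` Hom_perp u"
    "smooth_on S ?f"
    using smooth_plane_mapE[OF sm assms(2)] unfolding u_def by metis
  obtain r where r: "r > 0" "ball x0 r \<subseteq> S"
    using S(1,2) open_contains_ball by blast
  define B where "B y = ?f (x0 + y)" for y
  have yS: "x0 + y \<in> S" if "norm y < r" for y
    using r(2) that by (auto simp: subset_iff dist_norm)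
  have B: "B y \<in> Hom_perp u" "chart u (B y) = \<pi> (x0 + y)" if "norm y < r" for y
    using S(4)[OF yS[OF that]] chart_inv_chart[OF u] unfolding B_def by auto
  have CB: "Ck_on m (ball 0 r) B" for m
    unfolding B_def
    by (rule Ck_on_compose[where T=S])
      (use S yS in \<open>auto intro!: Ck_on_add Ck_on_const Ck_on_id simp: smooth_on_def\<close>)
  have B0: "B 0 = 0"
    using chart_eq_self[OF u B(1)[of 0]] B(2)[of 0] r(1) by (simp add: u_def)
  define \<beta> where "\<beta> = frechet_derivative B (at 0)"
  have DB: "(B has_derivative \<beta>) (at 0)"
    using Ck_on_SucD(1)[OF open_ball CB] r(1) unfolding \<beta>_def by simp
  have lin: "linear \<beta>" using DB has_derivative_linear by blast
  have \<beta>_mem: "\<beta> y \<in> Hom_perp u" for y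
    by (rule has_derivative_in_subspace[OF DB open_ball _ subspace_Hom_perp, of 0 r])
      (use r(1) B(1) in auto)
  have "((\<lambda>y. y - x0) has_derivative (\<lambda>v. v)) (at x0)"
    by (auto intro!: derivative_eq_intros)
  then have "((\<lambda>y. B (y - x0)) has_derivative \<beta>) (at x0)"
    by (rule has_derivative_compose) (simp add: DB)
  then have "(?f has_derivative \<beta>) (at x0)"
    by (simp add: B_def)
  note slice = frechet_derivative_slice[OF this opT assms(2) subspace_orthogonal_comp]
  have nd0: "\<beta> v *v t \<noteq> 0" if "v \<in> ?V" "t \<in> ospan u" "v \<noteq> 0" "t \<noteq> 0" for v t
    using nd[unfolded nondegenerate_def Let_def, rule_format, OF assms(2), folded u_def, OF that]
    unfolding slice[OF that(1)] .
  have focus: "v = 0" if "t \<in> ospan u" "v + \<beta> v *v t = 0" for v t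
    by (rule fibers_do_not_focus[OF fib sm assms(2) r(1) _ _ _ DB]) (use r(2) S(3) B that in \<open>auto simp: u_def\<close>)
  obtain c where c: "c > 0" "\<And>a t v. t \<in> ospan u \<Longrightarrow> v \<in> ?V \<Longrightarrow>
      c * norm (a::real, t) * norm v \<le> norm (a *\<^sub>R v + \<beta> v *v t)"
  proof (rule nonsingular_lower_bound[OF lin subspace_ospan[OF u] subspace_orthogonal_comp[of "ospan u"]])
    fix a :: real and t v
    assume t: "t \<in> ospan u" and v: "v \<in> ?V" "v \<noteq> 0" and at0: "(a, t) \<noteq> 0"
    show "a *\<^sub>R v + \<beta> v *v t \<noteq> 0"
    proof (cases "a = 0")
      case True
      then show ?thesis using nd0[OF v(1) t v(2)] at0 by (simp add: zero_prod_def)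
    next
      case False
      \<comment> \<open>Dividing by a reduces this case to the absence of focusing at parameter t /
        a.\<close>
      have "a *\<^sub>R v + \<beta> v *v t = a *\<^sub>R (v + \<beta> v *v (inverse a *\<^sub>R t))"
        using False by (simp add: scaleR_right_distrib matrix_vector_mult_scaleR)
      moreover have "v + \<beta> v *v (inverse a *\<^sub>R t) \<noteq> 0"
        using focus[of "inverse a *\<^sub>R t" v] subspace_scale[OF subspace_ospan[OF u] t] v(2) by blast
      ultimately show ?thesis using False by simp
    qed
  qed blast
  \<comment> \<open>The constant k compares the norm on matrices with their action on vectors; a
    cutoff with derivative bound c / (2 k) then meets the requirement c / 2 of the locale.\<close>
  obtain k where k: "k > 0" "\<And>(A::real^'n^'n) (t::real^'n). norm (A *v t) \<le> norm A * norm t * k"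
    using bounded_bilinear.pos_bounded[OF bounded_bilinear_matrix_vector_mult] by metis
  have ck: "c / (2 * k) > 0" using c k by simp
  obtain \<epsilon> H where \<epsilon>: "0 < \<epsilon>" "\<epsilon> < r" and CH: "\<And>m. Ck_on m UNIV H"
    and H1: "\<And>y. norm y < \<epsilon> / 2 \<Longrightarrow> H y = B y - \<beta> y"
    and H2: "\<And>y v. norm (frechet_derivative H (at y) v) \<le> c / (2 * k) * norm v"
    and H3: "\<And>y. norm y < r \<Longrightarrow> \<exists>a. H y = a *\<^sub>R (B y - \<beta> y)" "\<And>y. norm y \<ge> r \<Longrightarrow> H y = 0"
    by (rule cutoff_remainder[OF r(1) CB B0 ck, folded \<beta>_def]) (rule that; assumption)
  have H_mem: "H y \<in> Hom_perp u" for y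
  proof (cases "norm y < r")
    case True
    then obtain a where "H y = a *\<^sub>R (B y - \<beta> y)" using H3(1) by blast
    then show ?thesis
      using B(1)[OF True] \<beta>_mem by (simp add: subspace_scale subspace_diff subspace_Hom_perp)
  next
    case False
    then show ?thesis using H3(2) subspace_0[OF subspace_Hom_perp] by simp
  qed
  have H_bound: "norm (frechet_derivative H (at y) v *v t) \<le> c / 2 * norm v * norm t" for y v t
  proof -
    have "norm (frechet_derivative H (at y) v *v t) \<le> norm (frechet_derivative H (at y) v) * norm t * k"
      by (rule k)
    also have "\<dots> \<le> (c / (2 * k) * norm v) * norm t * k"
      using k(1) by (intro mult_right_mono H2) auto
    finally show ?thesis using k(1) by simp
  qed
  interpret perturbed_linear_fibration u P \<beta> H x0 c
    by (rule perturbed_linear_fibration.intro)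
      (assumption | intro u P lin \<beta>_mem H_mem CH c H_bound)+
  \<comment> \<open>These are the points whose new fiber meets x0 + \<open>V\<close> at distance
    less than \<epsilon>/2 from x0, where the slope \<open>C\<close> is exactly B. The given fiber
    is contained in it because \<Psi> is translation by -x0 there.\<close>
  define W where "W = {x. norm (q (\<Psi> x)) < \<epsilon> / 2}"
  have "continuous_on UNIV (\<lambda>x. q (\<Psi> x))"
    by (rule linear_continuous_on_compose[OF Ck_on_imp_continuous_on[OF Ck_\<Psi>] linear_q])
  then have "open W"
    unfolding W_def by (intro open_Collect_less continuous_on_norm continuous_on_const)
  moreover have "fiber \<pi> x0 \<subseteq> W"
  proof
    fix x assume "x \<in> fiber \<pi> x0"
    then obtain v where v: "x = x0 + v" "v \<in> ospan u"
      unfolding fiber_def u_def by blast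
    then have "q v = 0" by (simp add: q_def P_U)
    then have "C v = 0"
      using H1[of 0] \<epsilon>(1) B0 by (simp add: C_def)
    then have "\<Psi> x = v"
      using \<Psi>_\<Phi>[of v] v by (simp add: \<Phi>_def)
    then show "x \<in> W"
      using \<open>q v = 0\<close> \<epsilon>(1) by (simp add: W_def)
  qed
  \<comment> \<open>The point x lies on the plane through x0 + \<open>?y\<close> of slope
    \<open>B ?y\<close>, which is a fiber of the given fibration; so that fiber lies in
    \<open>T\<close> and both directions at x are the graph of \<open>B ?y\<close>.\<close>
  moreover have "x \<in> T \<and> direction x = \<pi> x" if "x \<in> W" for x
  proof -
    let ?z = "\<Psi> x" and ?y = "q (\<Psi> x)" and ?t = "P *v \<Psi> x"
    have y: "norm ?y < \<epsilon> / 2" "norm ?y < r"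
      using that \<epsilon> by (auto simp: W_def)
    have Cz: "C ?z = B ?y" using H1[OF y(1)] by (simp add: C_def)
    have "x = (x0 + ?y) + (?t + B ?y *v ?t)"
      using \<Phi>_\<Psi>[of x] \<Phi>_eq[of ?z] by (simp add: Cz algebra_simps)
    moreover have "?t + B ?y *v ?t \<in> ospan (\<pi> (x0 + ?y))"
      unfolding B(2)[OF y(2), symmetric] ospan_chart using P(1) by blast
    moreover have "x0 + ?y \<in> T" using yS[OF y(2)] S(3) by blast
    ultimately have "x \<in> T" "\<pi> x = \<pi> (x0 + ?y)"
      using plane_fibrationD[OF fib] by metis+
    then show ?thesis
      by (simp add: direction_def Cz B(2)[OF y(2)])
  qed
  ultimately show ?thesis
    using smooth_nondeg_fibration_direction by blast
qed

end
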